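(* Let $\Bbbk=[(k_{1,1},\dots,k_{1,r_{1}}),\dots,(k_{s,1},\dots,k_{s,r_{s}})]$ be an admissible cyclic index and put $k_{i}=\sum_{j=1}^{r_{i}}k_{i,j}$ for $1\le i\le s$. Then \[ \zeta_{\mathrm{cyc}}(\Bbbk)=\int_{D}\prod_{i=1}^{s}\prod_{j=1}^{k_{i}}a_{i,j}\,dt_{i,j}, \] where \[ a_{i,j}:=\begin{cases} \frac{1}{1-t_{i,j}} & j\in\{1,\,k_{i,1}+1,\,k_{i,1}+k_{i,2}+1,\dots,k_{i,1}+\cdots+k_{i,r_{i}-1}+1\},\\ \frac{1}{t_{i,j}} & \text{otherwise,} \end{cases} \] and \[ D:=\{(t_{1,1},\dots,t_{s,k_{s}})\in(0,1)^{k_{1}+\cdots+k_{s}}\mid t_{1,1}<\cdots<t_{1,k_{1}}>t_{2,1}<\cdots<t_{2,k_{2}}>\cdots>t_{s,1}<\cdots<t_{s,k_{s}}>t_{1,1}\}. \]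
   Context: An index $(k_1,\dots,k_r)\in\mathbb{Z}_{\ge1}^r$ is admissible if $k_r\ge2$. For $s\ge1$, $r_1,\dots,r_s\ge1$ and positive integers $k_{i,j}$, the multi-index $[(k_{1,1},\dots,k_{1,r_{1}}),\dots,(k_{s,1},\dots,k_{s,r_{s}})]$ is an admissible cyclic index if each $(k_{i,1},\dots,k_{i,r_i})$ is admissible or equal to $(1)$, and at least one $(k_{i,1},\dots,k_{i,r_i})$ is not equal to $(1)$. For such an index the cyclic multiple zeta value is \[ \zeta_{\mathrm{cyc}}(\Bbbk):=\sum_{(n_{1,1},\dots,n_{s,r_{s}})\in S}\prod_{i=1}^{s}\prod_{j=1}^{r_{i}}n_{i,j}^{-k_{i,j}}, \] where $S:=\{(n_{1,1},\dots,n_{s,r_{s}})\in\mathbb{Z}_{\geq1}^{r_{1}+\cdots+ r_{s}}\mid n_{1,1}<\cdots<n_{1,r_{1}}\geq n_{2,1}<\cdots<n_{2,r_{2}}\geq\cdots\geq n_{s,1}<\cdots<n_{s,r_{s}}\geq n_{1,1}\}$. *)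

theory Defs
  imports "HOL-Analysis.Analysis"
begin

text \<open>
  A multi-index is a list of lists \<open>kk\<close>; all positions are counted from \<open>0\<close>, so that
  \<open>kk ! i ! j\<close> is \<open>k\<^bsub>i+1,j+1\<^esub>\<close>. Families of numbers indexed by pairs \<open>(i, j)\<close> are extensional
  functions on \<open>nat \<times> nat\<close>.
\<close>

definition admissible_index :: "nat list \<Rightarrow> bool" where
  "admissible_index ks \<longleftrightarrow> ks \<noteq> [] \<and> (\<forall>k\<in>set ks. 1 \<le> k) \<and> 2 \<le> last ks"

definition admissible_cyclic_index :: "nat list list \<Rightarrow> bool" where
  "admissible_cyclic_index kk \<longleftrightarrow>
     kk \<noteq> [] \<and> (\<forall>ks\<in>set kk. admissible_index ks \<or> ks = [1]) \<and> (\<exists>ks\<in>set kk. ks \<noteq> [1])"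

text \<open>
  The pairs \<open>(i, j)\<close> with \<open>i < s\<close> and \<open>j < l i\<close>. It is used with \<open>l i = r\<^bsub>i+1\<^esub>\<close> for the sum and
  with \<open>l i = k\<^bsub>i+1\<^esub>\<close> for the integral.
\<close>

definition block_positions :: "nat \<Rightarrow> (nat \<Rightarrow> nat) \<Rightarrow> (nat \<times> nat) set" where
  "block_positions s l = (SIGMA i:{..<s}. {..<l i})"

definition depth_of :: "nat list list \<Rightarrow> nat \<Rightarrow> nat" where
  "depth_of kk i = length (kk ! i)"

definition weight_of :: "nat list list \<Rightarrow> nat \<Rightarrow> nat" where
  "weight_of kk i = sum_list (kk ! i)"

text \<open>
  \<open>Suc i mod length kk\<close> is the block following block \<open>i\<close> cyclically; for a single block
  it is that block itself.
\<close>

definition cyc_summation_set :: "nat list list \<Rightarrow> (nat \<times> nat \<Rightarrow> nat) set" where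
  "cyc_summation_set kk =
     {n \<in> block_positions (length kk) (depth_of kk) \<rightarrow>\<^sub>E {1..}.
        \<forall>i<length kk.
          (\<forall>j. Suc j < depth_of kk i \<longrightarrow> n (i, j) < n (i, Suc j)) \<and>
          n (i, depth_of kk i - 1) \<ge> n (Suc i mod length kk, 0)}"

definition cyc_summand :: "nat list list \<Rightarrow> (nat \<times> nat \<Rightarrow> nat) \<Rightarrow> real" where
  "cyc_summand kk n =
     (\<Prod>i<length kk. \<Prod>j<depth_of kk i. 1 / real (n (i, j)) ^ (kk ! i ! j))"

definition zeta_cyc :: "nat list list \<Rightarrow> real" where
  "zeta_cyc kk = infsum (cyc_summand kk) (cyc_summation_set kk)"

definition cyc_domain :: "nat list list \<Rightarrow> (nat \<times> nat \<Rightarrow> real) set" where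
  "cyc_domain kk =
     {t \<in> block_positions (length kk) (weight_of kk) \<rightarrow>\<^sub>E {0<..<1}.
        \<forall>i<length kk.
          (\<forall>j. Suc j < weight_of kk i \<longrightarrow> t (i, j) < t (i, Suc j)) \<and>
          t (i, weight_of kk i - 1) > t (Suc i mod length kk, 0)}"

definition cyc_form :: "nat list list \<Rightarrow> nat \<Rightarrow> nat \<Rightarrow> real \<Rightarrow> real" where
  "cyc_form kk i j x =
     (if j \<in> {sum_list (take m (kk ! i)) | m. m < depth_of kk i} then 1 / (1 - x) else 1 / x)"

definition cyc_integrand :: "nat list list \<Rightarrow> (nat \<times> nat \<Rightarrow> real) \<Rightarrow> real" where
  "cyc_integrand kk t = (\<Prod>i<length kk. \<Prod>j<weight_of kk i. cyc_form kk i j (t (i, j)))"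

definition cyc_measure :: "nat list list \<Rightarrow> (nat \<times> nat \<Rightarrow> real) measure" where
  "cyc_measure kk = Pi\<^sub>M (block_positions (length kk) (weight_of kk)) (\<lambda>_. lborel)"

end

theory Submission
  imports Defs
begin

text \<open>
  Both sides are traces of products of nonnegative kernels, over Lebesgue measure on \<open>(0,1)\<close> and over
  counting measure on the positive integers, and Tonelli makes such a trace invariant under cyclic
  rotation. Rotate so that the first block is admissible and cut the cycle in front of it, using that
  \<open>t > t'\<close> is the complement of \<open>t < t'\<close> up to a null set (and \<open>n \<ge> n'\<close> of \<open>n < n'\<close>): the cyclic
  quantity plus the one in which the last block is merged with the first equals an open zigzag
  without the closing condition. The merged term has one block less, or vanishes because it asks for
  a strictly increasing cycle, so induction on the number of blocks reduces the theorem to open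
  zigzags. There the integral is evaluated from the first variable onwards: \<open>t\<^sup>n\<^sup>-\<^sup>1 dt\<close> is carried by
  \<open>dt/t\<close> to itself divided by \<open>n\<close>, by an ascending \<open>dt/(1-t)\<close> to \<open>1/n\<close> times the sum over \<open>m > n\<close>,
  and by a descending \<open>dt/(1-t)\<close> to \<open>1/n\<close> times the sum over \<open>m \<le> n\<close>. Finiteness, needed to cancel
  the merged term, follows from the bound \<open>C \<surd>n\<close> for the tails of the sum.
\<close>

section \<open>Traces of products of kernels\<close>

text \<open>The integral operators with kernels \<open>ks\<close>, composed and applied to the
  terminal function \<open>h\<close>. Keeping \<open>h\<close> as an argument allows the kernel that
  closes a cycle to be placed there.\<close>

primrec kern_chain :: "'a measure \<Rightarrow> ('a \<Rightarrow> ennreal) \<Rightarrow> ('a \<Rightarrow> 'a \<Rightarrow> ennreal) list \<Rightarrow> 'a \<Rightarrow> ennreal" where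
  "kern_chain M h [] x = h x"
| "kern_chain M h (k # ks) x = (\<integral>\<^sup>+y. k x y * kern_chain M h ks y \<partial>M)"

text \<open>The trace of the composed operators. The head kernel is the one that enters the base
  point \<open>u\<close>: it leads from the last variable back to \<open>u\<close> and is therefore
  the terminal function of the remaining chain.\<close>

fun kern_trace :: "'a measure \<Rightarrow> ('a \<Rightarrow> 'a \<Rightarrow> ennreal) list \<Rightarrow> ennreal" where
  "kern_trace M [] = 0"
| "kern_trace M (k # ks) = (\<integral>\<^sup>+u. kern_chain M (\<lambda>y. k y u) ks u \<partial>M)"

definition kernel_on :: "'a measure \<Rightarrow> ('a \<Rightarrow> 'a \<Rightarrow> ennreal) \<Rightarrow> bool" where
  "kernel_on M k \<longleftrightarrow> case_prod k \<in> borel_measurable (M \<Otimes>\<^sub>M M)"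

lemma kernel_on_compose:
  assumes "kernel_on M k" "f \<in> measurable N M" "g \<in> measurable N M"
  shows "(\<lambda>x. k (f x) (g x)) \<in> borel_measurable N"
proof -
  have "(\<lambda>x. case_prod k (f x, g x)) \<in> borel_measurable N"
    using assms unfolding kernel_on_def
    by (intro measurable_compose[OF measurable_Pair]) auto
  then show ?thesis by simp
qed

lemma kern_chain_append:
  "kern_chain M h (ks @ ls) x = kern_chain M (kern_chain M h ls) ks x"
  by (induction ks arbitrary: x) simp_all

context sigma_finite_measure
begin

text \<open>In a trace the terminal function depends on the base point, so Tonelli asks for
  measurability jointly in the parameter \<open>u\<close> and the start \<open>x\<close>.\<close>

lemma borel_measurable_kern_chain_param:
  assumes "\<And>k. k \<in> set ks \<Longrightarrow> kernel_on M k"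
    and h: "case_prod h \<in> borel_measurable (N \<Otimes>\<^sub>M M)"
  shows "(\<lambda>(u, x). kern_chain M (h u) ks x) \<in> borel_measurable (N \<Otimes>\<^sub>M M)"
  using assms(1)
proof (induction ks)
  case Nil
  then show ?case using h by simp
next
  case (Cons k ks)
  have k: "kernel_on M k" using Cons.prems by simp
  have IH: "(\<lambda>(u, x). kern_chain M (h u) ks x) \<in> borel_measurable (N \<Otimes>\<^sub>M M)"
    using Cons by simp
  have "(\<lambda>(p, y). k (snd p) y * kern_chain M (h (fst p)) ks y)
      \<in> borel_measurable ((N \<Otimes>\<^sub>M M) \<Otimes>\<^sub>M M)"
  proof -
    have 1: "(\<lambda>q. k (snd (fst q)) (snd q)) \<in> borel_measurable ((N \<Otimes>\<^sub>M M) \<Otimes>\<^sub>M M)"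
      by (rule kernel_on_compose[OF k]) simp_all
    have "(\<lambda>q. (\<lambda>(u, x). kern_chain M (h u) ks x) (fst (fst q), snd q))
        \<in> borel_measurable ((N \<Otimes>\<^sub>M M) \<Otimes>\<^sub>M M)"
      by (rule measurable_compose[OF measurable_Pair IH]) simp_all
    then have 2: "(\<lambda>q. kern_chain M (h (fst (fst q))) ks (snd q))
        \<in> borel_measurable ((N \<Otimes>\<^sub>M M) \<Otimes>\<^sub>M M)" by simp
    show ?thesis using borel_measurable_times_ennreal[OF 1 2] by (simp add: case_prod_beta')
  qed
  from borel_measurable_nn_integral[OF this]
  show ?case by (simp add: case_prod_beta')
qed

lemma borel_measurable_kern_chain:
  assumes "\<And>k. k \<in> set ks \<Longrightarrow> kernel_on M k" and h: "h \<in> borel_measurable M"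
  shows "kern_chain M h ks \<in> borel_measurable M"
proof -
  have "(\<lambda>(u, x). kern_chain M ((\<lambda>_. h) u) ks x) \<in> borel_measurable (M \<Otimes>\<^sub>M M)"
    by (rule borel_measurable_kern_chain_param[OF assms(1)]) (use h in measurable)
  then have "(\<lambda>x. (\<lambda>(u, x). kern_chain M ((\<lambda>_. h) u) ks x) (x, x)) \<in> borel_measurable M"
    by (intro measurable_compose[OF measurable_Pair]) simp_all
  then show ?thesis by simp
qed

lemma kern_chain_cmult:
  assumes "\<And>k. k \<in> set ks \<Longrightarrow> kernel_on M k" "h \<in> borel_measurable M" "x \<in> space M"
  shows "kern_chain M (\<lambda>y. c * h y) ks x = c * kern_chain M h ks x"
  using assms(1,3)
proof (induction ks arbitrary: x)
  case (Cons k ks)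
  have "(\<integral>\<^sup>+y. k x y * kern_chain M (\<lambda>y. c * h y) ks y \<partial>M)
      = (\<integral>\<^sup>+y. c * (k x y * kern_chain M h ks y) \<partial>M)"
    by (rule nn_integral_cong) (simp add: Cons mult_ac)
  also have "\<dots> = c * (\<integral>\<^sup>+y. k x y * kern_chain M h ks y \<partial>M)"
    by (intro nn_integral_cmult borel_measurable_times_ennreal borel_measurable_kern_chain assms(2)
        kernel_on_compose[of M]) (use Cons.prems in auto)
  finally show ?case by simp
qed simp

lemma kern_chain_add:
  assumes "\<And>k. k \<in> set ks \<Longrightarrow> kernel_on M k" "h \<in> borel_measurable M" "h' \<in> borel_measurable M"
    "x \<in> space M"
  shows "kern_chain M (\<lambda>y. h y + h' y) ks x = kern_chain M h ks x + kern_chain M h' ks x"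
  using assms(1,4)
proof (induction ks arbitrary: x)
  case (Cons k ks)
  have "(\<integral>\<^sup>+y. k x y * kern_chain M (\<lambda>y. h y + h' y) ks y \<partial>M)
      = (\<integral>\<^sup>+y. k x y * kern_chain M h ks y + k x y * kern_chain M h' ks y \<partial>M)"
    by (rule nn_integral_cong) (simp add: Cons ring_distribs)
  also have "\<dots> = (\<integral>\<^sup>+y. k x y * kern_chain M h ks y \<partial>M)
      + (\<integral>\<^sup>+y. k x y * kern_chain M h' ks y \<partial>M)"
    by (intro nn_integral_add borel_measurable_times_ennreal borel_measurable_kern_chain assms(2,3)
        kernel_on_compose[of M]) (use Cons.prems in auto)
  finally show ?case by simp
qed simp

text \<open>A chain is linear in its terminal function, and for nonnegative kernels this extends
  from finite sums to integrals by Tonelli, one kernel at a time.\<close>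

lemma kern_chain_integral:
  assumes "\<And>k. k \<in> set ks \<Longrightarrow> kernel_on M k" "x \<in> space M" "sigma_finite_measure N"
    and h: "case_prod h \<in> borel_measurable (N \<Otimes>\<^sub>M M)"
  shows "(\<integral>\<^sup>+u. kern_chain M (h u) ks x \<partial>N) = kern_chain M (\<lambda>y. \<integral>\<^sup>+u. h u y \<partial>N) ks x"
  using assms(1,2)
proof (induction ks arbitrary: x)
  case (Cons k ks)
  interpret P: pair_sigma_finite N M
    using assms(3) sigma_finite_measure_axioms by (simp add: pair_sigma_finite_def)
  have m: "(\<lambda>(u, y). kern_chain M (h u) ks y) \<in> borel_measurable (N \<Otimes>\<^sub>M M)"
    by (rule borel_measurable_kern_chain_param[OF _ h]) (use Cons.prems in auto)
  have k: "k x \<in> borel_measurable M"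
    by (rule kernel_on_compose[of M k "\<lambda>_. x" M "\<lambda>y. y"]) (use Cons.prems in auto)
  have km: "(\<lambda>(u, y). k x y * kern_chain M (h u) ks y) \<in> borel_measurable (N \<Otimes>\<^sub>M M)"
    using borel_measurable_times_ennreal[OF measurable_compose[OF measurable_snd k] m]
    by (simp add: case_prod_beta')
  have "(\<integral>\<^sup>+u. kern_chain M (h u) (k # ks) x \<partial>N)
      = (\<integral>\<^sup>+y. (\<integral>\<^sup>+u. k x y * kern_chain M (h u) ks y \<partial>N) \<partial>M)"
    using P.Fubini'[OF km] by simp
  also have "\<dots> = (\<integral>\<^sup>+y. k x y * (\<integral>\<^sup>+u. kern_chain M (h u) ks y \<partial>N) \<partial>M)"
  proof (rule nn_integral_cong)
    fix y assume y: "y \<in> space M"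
    have "(\<lambda>u. (\<lambda>(u, y). kern_chain M (h u) ks y) (u, y)) \<in> borel_measurable N"
      by (rule measurable_compose[OF measurable_Pair m]) (use y in auto)
    then show "(\<integral>\<^sup>+u. k x y * kern_chain M (h u) ks y \<partial>N) = k x y * (\<integral>\<^sup>+u. kern_chain M (h u) ks y \<partial>N)"
      by (simp add: nn_integral_cmult)
  qed
  also have "\<dots> = kern_chain M (\<lambda>y. \<integral>\<^sup>+u. h u y \<partial>N) (k # ks) x"
    using Cons by (auto intro!: nn_integral_cong)
  finally show ?case .
qed simp

text \<open>For a list beginning with \<open>k0\<close>, \<open>k1\<close>, the chain first moves
  from \<open>u\<close> to \<open>v\<close> through \<open>k1\<close>. Exchanging the integrals over
  \<open>u\<close> and \<open>v\<close> makes \<open>v\<close> the base point, and linearity in the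
  terminal function carries the integral over \<open>u\<close> to the far end of the chain.\<close>

lemma kern_trace_rotate1:
  assumes "\<And>k. k \<in> set ks \<Longrightarrow> kernel_on M k"
  shows "kern_trace M (rotate1 ks) = kern_trace M ks"
proof (cases ks)
  case Nil
  then show ?thesis by simp
next
  case (Cons k0 ks')
  show ?thesis
  proof (cases ks')
    case Nil
    with Cons show ?thesis by simp
  next
    case (Cons k1 ls)
    have ks: "ks = k0 # k1 # ls" using \<open>ks = _\<close> Cons by simp
    have k0: "kernel_on M k0" and k1: "kernel_on M k1" and ls: "\<And>k. k \<in> set ls \<Longrightarrow> kernel_on M k"
      using assms ks by auto
    interpret P: pair_sigma_finite M M by (simp add: pair_sigma_finite_def sigma_finite_measure_axioms)
    have sec: "(\<lambda>y. k0 y u) \<in> borel_measurable M" if "u \<in> space M" for u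
      by (rule kernel_on_compose[OF k0]) (use that in auto)
    have "(\<lambda>(u, y). k0 y u) \<in> borel_measurable (M \<Otimes>\<^sub>M M)"
      using kernel_on_compose[OF k0, of snd "M \<Otimes>\<^sub>M M" fst] by (simp add: case_prod_beta')
    from borel_measurable_kern_chain_param[OF ls this]
    have m: "(\<lambda>(u, v). k1 u v * kern_chain M (\<lambda>y. k0 y u) ls v) \<in> borel_measurable (M \<Otimes>\<^sub>M M)"
      using k1 by (auto simp: kernel_on_def case_prod_beta')
    have "kern_trace M ks = (\<integral>\<^sup>+v. (\<integral>\<^sup>+u. k1 u v * kern_chain M (\<lambda>y. k0 y u) ls v \<partial>M) \<partial>M)"
      using P.Fubini'[OF m] by (simp add: ks)
    also have "\<dots> = (\<integral>\<^sup>+v. (\<integral>\<^sup>+u. kern_chain M (\<lambda>y. k1 u v * k0 y u) ls v \<partial>M) \<partial>M)"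
      by (intro nn_integral_cong kern_chain_cmult[symmetric] sec ls) auto
    also have "\<dots> = (\<integral>\<^sup>+v. kern_chain M (\<lambda>y. \<integral>\<^sup>+u. k1 u v * k0 y u \<partial>M) ls v \<partial>M)"
    proof (intro nn_integral_cong kern_chain_integral ls sigma_finite_measure_axioms)
      fix v assume v: "v \<in> space M"
      have "(\<lambda>p. k1 (fst p) v * k0 (snd p) (fst p)) \<in> borel_measurable (M \<Otimes>\<^sub>M M)"
        by (intro borel_measurable_times_ennreal kernel_on_compose[OF k1] kernel_on_compose[OF k0])
          (use v in auto)
      then show "(\<lambda>(u, y). k1 u v * k0 y u) \<in> borel_measurable (M \<Otimes>\<^sub>M M)"
        by (simp add: case_prod_beta')
    qed auto
    also have "\<dots> = kern_trace M (rotate1 ks)"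
    proof -
      \<comment> \<open>The integral over \<open>u\<close> is itself a chain through
        \<open>k0\<close> with terminal function \<open>k1 u v\<close>: \<open>k0\<close> becomes
        the last kernel and \<open>k1\<close> the closing one.\<close>
      have "kern_chain M (\<lambda>u. k1 u v) [k0] = (\<lambda>y. \<integral>\<^sup>+u. k1 u v * k0 y u \<partial>M)" for v
        by (rule ext) (simp add: mult.commute)
      then show ?thesis by (simp only: ks kern_chain_append kern_trace.simps rotate1.simps append.simps)
    qed
    finally show ?thesis by simp
  qed
qed

lemma kern_trace_append_commute:
  assumes "\<And>k. k \<in> set (ks @ ls) \<Longrightarrow> kernel_on M k"
  shows "kern_trace M (ks @ ls) = kern_trace M (ls @ ks)"
  using assms
proof (induction ks arbitrary: ls)
  case (Cons k ks)
  have "kern_trace M ((k # ks) @ ls) = kern_trace M (rotate1 ((k # ks) @ ls))"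
    using Cons.prems by (intro kern_trace_rotate1[symmetric]) auto
  also have "\<dots> = kern_trace M (ks @ (ls @ [k]))" by simp
  also have "\<dots> = kern_trace M ((ls @ [k]) @ ks)"
    by (rule Cons.IH) (use Cons.prems in auto)
  finally show ?case by simp
qed simp

lemma kern_trace_head_add:
  assumes "\<And>l. l \<in> set ks \<Longrightarrow> kernel_on M l" and k: "kernel_on M k" "kernel_on M k'"
  shows "kern_trace M ((\<lambda>x y. k x y + k' x y) # ks) = kern_trace M (k # ks) + kern_trace M (k' # ks)"
proof -
  have sec: "(\<lambda>y. l y u) \<in> borel_measurable M" if "kernel_on M l" "u \<in> space M" for l u
    by (rule kernel_on_compose[OF that(1)]) (use that in auto)
  have m: "(\<lambda>u. kern_chain M (\<lambda>y. l y u) ks u) \<in> borel_measurable M" if l: "kernel_on M l" for l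
  proof -
    have "(\<lambda>(u, y). l y u) \<in> borel_measurable (M \<Otimes>\<^sub>M M)"
      using kernel_on_compose[OF l, of snd "M \<Otimes>\<^sub>M M" fst] by (simp add: case_prod_beta')
    from borel_measurable_kern_chain_param[OF assms(1) this, of ks]
    have "(\<lambda>(u, x). kern_chain M (\<lambda>y. l y u) ks x) \<in> borel_measurable (M \<Otimes>\<^sub>M M)" by simp
    from measurable_compose[OF measurable_Pair this, of "\<lambda>u. u" M "\<lambda>u. u"]
    have "(\<lambda>u. (\<lambda>(u, x). kern_chain M (\<lambda>y. l y u) ks x) (u, u)) \<in> borel_measurable M"
      by simp
    then show ?thesis by simp
  qed
  have "kern_trace M ((\<lambda>x y. k x y + k' x y) # ks)
      = (\<integral>\<^sup>+u. kern_chain M (\<lambda>y. k y u) ks u + kern_chain M (\<lambda>y. k' y u) ks u \<partial>M)"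
    using assms sec by (auto intro!: nn_integral_cong kern_chain_add)
  then show ?thesis using nn_integral_add[OF m m] k by simp
qed

text \<open>A head kernel that ignores its first argument imposes no closing condition, so the cycle
  opens into a path with weight \<open>f\<close> at its start.\<close>

lemma kern_trace_free:
  assumes "\<And>k. k \<in> set ks \<Longrightarrow> kernel_on M k"
  shows "kern_trace M ((\<lambda>_. f) # ks) = (\<integral>\<^sup>+u. f u * kern_chain M (\<lambda>_. 1) ks u \<partial>M)"
proof -
  have "kern_chain M (\<lambda>_. f u * 1) ks u = f u * kern_chain M (\<lambda>_. 1) ks u" if "u \<in> space M" for u
    by (rule kern_chain_cmult) (use assms that in auto)
  then show ?thesis by (auto intro!: nn_integral_cong)
qed

end

text \<open>The last kernel integrates over the argument of \<open>h\<close>, so changes on a null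
  set are invisible. The empty chain would instead evaluate \<open>h\<close> at the point
  \<open>x\<close>.\<close>

lemma kern_chain_AE_cong:
  assumes "AE y in M. h y = h' y" "ks \<noteq> []"
  shows "kern_chain M h ks x = kern_chain M h' ks x"
  using assms(2)
proof (induction ks arbitrary: x)
  case (Cons k ks)
  show ?case
  proof (cases "ks = []")
    case True
    then show ?thesis using assms(1) by (auto intro!: nn_integral_cong_AE elim: AE_mp)
  next
    case False
    then show ?thesis using Cons.IH[OF False] by simp
  qed
qed simp

text \<open>All variables of a nonzero contribution lie at or above the start \<open>x\<close>,
  where \<open>h\<close> is zero.\<close>

lemma kern_chain_strict_zero:
  fixes x :: "'a :: linorder"
  assumes "\<And>k x y. k \<in> set ks \<Longrightarrow> \<not> x < y \<Longrightarrow> k x y = 0" "\<And>y. x \<le> y \<Longrightarrow> h y = 0"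
  shows "kern_chain M h ks x = 0"
  using assms
proof (induction ks arbitrary: x)
  case (Cons k ks)
  have "k x y * kern_chain M h ks y = 0" for y
  proof (cases "x < y")
    case True
    then show ?thesis using Cons.IH[of y] Cons.prems by auto
  qed (use Cons.prems in auto)
  then show ?case by (simp only: kern_chain.simps) simp
qed simp

text \<open>A cycle along which every step strictly increases cannot return to its base
  point.\<close>

lemma kern_trace_strict_zero:
  fixes M :: "'a :: linorder measure"
  assumes "\<And>k x y. k \<in> set ks \<Longrightarrow> \<not> x < y \<Longrightarrow> k x y = 0"
  shows "kern_trace M ks = 0"
proof (cases ks)
  case (Cons k ls)
  have "kern_chain M (\<lambda>y. k y u) ls u = 0" for u
    by (rule kern_chain_strict_zero) (use assms Cons in auto)
  then show ?thesis using Cons by simp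
qed simp

section \<open>Cyclic products over finite product spaces\<close>

text \<open>The integrand of \<open>kern_chain\<close> before integration, with the variables
  indexed by positions; \<open>L p\<close> is the kernel that enters position
  \<open>p\<close>.\<close>

primrec path_weight ::
    "('p \<Rightarrow> 'a \<Rightarrow> 'a \<Rightarrow> ennreal) \<Rightarrow> ('a \<Rightarrow> ennreal) \<Rightarrow> 'a \<Rightarrow> 'p list \<Rightarrow> ('p \<Rightarrow> 'a) \<Rightarrow> ennreal" where
  "path_weight L h x [] t = h x"
| "path_weight L h x (p # ps) t = L p x (t p) * path_weight L h (t p) ps t"

lemma path_weight_upd:
  "p \<notin> set ps \<Longrightarrow> path_weight L h x ps (t(p := y)) = path_weight L h x ps t"
  by (induction ps arbitrary: x) auto

lemma path_weight_eq_prod: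
  assumes "successively (\<lambda>p q. prev q = p) (p0 # ps)" "distinct ps"
  shows "path_weight L h (t p0) ps t = (\<Prod>q\<in>set ps. L q (t (prev q)) (t q)) * h (t (last (p0 # ps)))"
  using assms
proof (induction ps arbitrary: p0)
  case (Cons p ps)
  have "path_weight L h (t p) ps t = (\<Prod>q\<in>set ps. L q (t (prev q)) (t q)) * h (t (last (p # ps)))"
    by (rule Cons.IH) (use Cons.prems in auto)
  with Cons.prems show ?case by (simp add: mult.assoc)
qed simp

lemma borel_measurable_path_weight:
  assumes "\<And>p. p \<in> set ps \<Longrightarrow> kernel_on M (L p)" "h \<in> borel_measurable M" "set ps \<subseteq> I"
    "f \<in> measurable (Pi\<^sub>M I (\<lambda>_. M)) M"
  shows "(\<lambda>t. path_weight L h (f t) ps t) \<in> borel_measurable (Pi\<^sub>M I (\<lambda>_. M))"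
  using assms(1,3,4)
proof (induction ps arbitrary: f)
  case Nil
  then show ?case using measurable_compose[OF _ assms(2)] by simp
next
  case (Cons p ps)
  have p: "(\<lambda>t. t p) \<in> measurable (Pi\<^sub>M I (\<lambda>_. M)) M"
    using Cons.prems by (intro measurable_component_singleton) auto
  have "(\<lambda>t. path_weight L h (t p) ps t) \<in> borel_measurable (Pi\<^sub>M I (\<lambda>_. M))"
    by (rule Cons.IH[OF _ _ p]) (use Cons.prems in auto)
  moreover have "(\<lambda>t. L p (f t) (t p)) \<in> borel_measurable (Pi\<^sub>M I (\<lambda>_. M))"
    by (rule kernel_on_compose[of M]) (use Cons.prems p in auto)
  ultimately show ?case by simp
qed

context sigma_finite_measure
begin

lemma nn_integral_path_weight:
  assumes "\<And>p. p \<in> set ps \<Longrightarrow> kernel_on M (L p)" "h \<in> borel_measurable M" "distinct ps" "x \<in> space M"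
  shows "(\<integral>\<^sup>+t. path_weight L h x ps t \<partial>Pi\<^sub>M (set ps) (\<lambda>_. M)) = kern_chain M h (map L ps) x"
  using assms(1,3,4)
proof (induction ps arbitrary: x)
  case Nil
  interpret product_sigma_finite "\<lambda>_ :: 'b. M"
    by (simp add: product_sigma_finite_def sigma_finite_measure_axioms)
  show ?case by (simp add: PiM_empty)
next
  case (Cons p ps)
  interpret product_sigma_finite "\<lambda>_ :: 'b. M"
    by (simp add: product_sigma_finite_def sigma_finite_measure_axioms)
  have p: "p \<notin> set ps" using Cons.prems by simp
  have m: "(\<lambda>t. path_weight L h x (p # ps) t) \<in> borel_measurable (Pi\<^sub>M (insert p (set ps)) (\<lambda>_. M))"
    by (rule borel_measurable_path_weight[OF _ assms(2)]) (use Cons.prems in auto)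
  have "(\<integral>\<^sup>+t. path_weight L h x (p # ps) t \<partial>Pi\<^sub>M (set (p # ps)) (\<lambda>_. M))
      = (\<integral>\<^sup>+y. (\<integral>\<^sup>+t. path_weight L h x (p # ps) (t(p := y)) \<partial>Pi\<^sub>M (set ps) (\<lambda>_. M)) \<partial>M)"
    using product_nn_integral_insert_rev[OF _ p m] by simp
  also have "\<dots> = (\<integral>\<^sup>+y. (\<integral>\<^sup>+t. L p x y * path_weight L h y ps t \<partial>Pi\<^sub>M (set ps) (\<lambda>_. M)) \<partial>M)"
    using p by (simp add: path_weight_upd)
  also have "\<dots> = (\<integral>\<^sup>+y. L p x y * (\<integral>\<^sup>+t. path_weight L h y ps t \<partial>Pi\<^sub>M (set ps) (\<lambda>_. M)) \<partial>M)"
    by (intro nn_integral_cong nn_integral_cmult borel_measurable_path_weight[OF _ assms(2)])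
      (use Cons.prems in auto)
  also have "\<dots> = (\<integral>\<^sup>+y. L p x y * kern_chain M h (map L ps) y \<partial>M)"
    by (rule nn_integral_cong) (use Cons in auto)
  finally show ?case by simp
qed

text \<open>With the value at the first position fixed to \<open>u\<close>, the other factors form a
  path starting at \<open>u\<close>, and the factor that belongs to the first position closes
  it.\<close>

lemma nn_integral_cyclic_prod:
  assumes L: "\<And>p. p \<in> set ps \<Longrightarrow> kernel_on M (L p)" and "ps \<noteq> []" "distinct ps"
    and succ: "successively (\<lambda>p q. prev q = p) ps" and "prev (hd ps) = last ps"
  shows "(\<lambda>t. \<Prod>p\<in>set ps. L p (t (prev p)) (t p)) \<in> borel_measurable (Pi\<^sub>M (set ps) (\<lambda>_. M))"
    and "(\<integral>\<^sup>+t. (\<Prod>p\<in>set ps. L p (t (prev p)) (t p)) \<partial>Pi\<^sub>M (set ps) (\<lambda>_. M))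
      = kern_trace M (map L ps)"
proof -
  obtain p0 qs where ps: "ps = p0 # qs" using assms(2) by (cases ps) auto
  interpret product_sigma_finite "\<lambda>_ :: 'b. M"
    by (simp add: product_sigma_finite_def sigma_finite_measure_axioms)
  let ?F = "\<lambda>t. \<Prod>p\<in>set ps. L p (t (prev p)) (t p)"
  \<comment> \<open>Keeps the predecessor among the coordinates of the product space, so that
    \<open>t (prev p)\<close> is a coordinate projection.\<close>
  have prev: "prev p \<in> set ps" if p: "p \<in> set ps" for p
  proof -
    obtain n where n: "n < length ps" "p = ps ! n" using p by (auto simp: in_set_conv_nth)
    show ?thesis
    proof (cases n)
      case 0
      then show ?thesis using n assms(2,5) by (simp add: hd_conv_nth)
    next
      case (Suc m)
      then show ?thesis using n succ by (auto simp: successively_conv_nth)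
    qed
  qed
  show m: "?F \<in> borel_measurable (Pi\<^sub>M (set ps) (\<lambda>_. M))"
    by (intro borel_measurable_prod_ennreal kernel_on_compose[OF L] measurable_component_singleton prev)
  have F: "?F t = path_weight L (\<lambda>y. L p0 y (t p0)) (t p0) qs t" for t
    using path_weight_eq_prod[of prev p0 qs L "\<lambda>y. L p0 y (t p0)" t] assms ps by (simp add: mult.commute)
  have p0: "p0 \<notin> set qs" using assms ps by simp
  have "(\<integral>\<^sup>+t. ?F t \<partial>Pi\<^sub>M (set ps) (\<lambda>_. M))
      = (\<integral>\<^sup>+u. (\<integral>\<^sup>+t. ?F (t(p0 := u)) \<partial>Pi\<^sub>M (set qs) (\<lambda>_. M)) \<partial>M)"
    using product_nn_integral_insert_rev[OF _ p0, of ?F] m ps by simp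
  also have "\<dots> = (\<integral>\<^sup>+u. (\<integral>\<^sup>+t. path_weight L (\<lambda>y. L p0 y u) u qs t \<partial>Pi\<^sub>M (set qs) (\<lambda>_. M)) \<partial>M)"
    unfolding F using p0 by (simp add: path_weight_upd)
  also have "\<dots> = (\<integral>\<^sup>+u. kern_chain M (\<lambda>y. L p0 y u) (map L qs) u \<partial>M)"
    by (intro nn_integral_cong nn_integral_path_weight kernel_on_compose[of M "L p0"])
      (use assms ps in auto)
  finally show "(\<integral>\<^sup>+t. ?F t \<partial>Pi\<^sub>M (set ps) (\<lambda>_. M)) = kern_trace M (map L ps)"
    by (simp add: ps)
qed

end

section \<open>Enumeration of the positions in cyclic order\<close>

definition pos_list :: "nat \<Rightarrow> (nat \<Rightarrow> nat) \<Rightarrow> (nat \<times> nat) list" where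
  "pos_list s l = concat (map (\<lambda>i. map (Pair i) [0..<l i]) [0..<s])"

text \<open>The cyclic predecessor: the position whose variable is compared with that of
  \<open>p\<close>. The first position is preceded by the last one, also when there is only one
  block.\<close>

definition prev_pos :: "nat \<Rightarrow> (nat \<Rightarrow> nat) \<Rightarrow> nat \<times> nat \<Rightarrow> nat \<times> nat" where
  "prev_pos s l p = (case p of (i, Suc j) \<Rightarrow> (i, j)
     | (0, 0) \<Rightarrow> (s - 1, l (s - 1) - 1) | (Suc i, 0) \<Rightarrow> (i, l i - 1))"

lemma prev_pos_simps [simp]:
  "prev_pos s l (i, Suc j) = (i, j)"
  "prev_pos s l (0, 0) = (s - 1, l (s - 1) - 1)"
  "prev_pos s l (Suc i, 0) = (i, l i - 1)"
  by (auto simp: prev_pos_def split: nat.split)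

lemma pos_list_Suc: "pos_list (Suc s) l = pos_list s l @ map (Pair s) [0..<l s]"
  by (simp add: pos_list_def)

lemma set_pos_list: "set (pos_list s l) = block_positions s l"
  by (auto simp: pos_list_def block_positions_def)

lemma distinct_pos_list: "distinct (pos_list s l)"
proof (induction s)
  case (Suc s)
  then show ?case
    by (auto simp: pos_list_Suc distinct_map inj_on_def set_pos_list block_positions_def)
qed (simp add: pos_list_def)

lemma pos_list_ends:
  assumes "s > 0" "\<And>i. i < s \<Longrightarrow> l i > 0"
  shows "pos_list s l \<noteq> [] \<and> hd (pos_list s l) = (0, 0) \<and> last (pos_list s l) = (s - 1, l (s - 1) - 1)"
  using assms
proof (induction s)
  case (Suc s)
  have "l s > 0" using Suc.prems by simp
  then have "hd (map (Pair s) [0..<l s]) = (s, 0)" "last (map (Pair s) [0..<l s]) = (s, l s - 1)"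
    by (simp_all add: hd_map last_map)
  with Suc \<open>l s > 0\<close> show ?case
    by (cases "s = 0") (auto simp: pos_list_Suc pos_list_def)
qed simp

lemma successively_pos_list:
  assumes "\<And>i. i < s \<Longrightarrow> l i > 0" "r \<le> s"
  shows "successively (\<lambda>p q. prev_pos s l q = p) (pos_list r l)"
  using assms(2)
proof (induction r)
  case 0
  then show ?case by (simp add: pos_list_def)
next
  case (Suc r)
  have "successively (\<lambda>p q. prev_pos s l q = p) (map (Pair r) [0..<l r])"
    by (auto simp: successively_conv_nth)
  moreover have "prev_pos s l (hd (map (Pair r) [0..<l r])) = last (pos_list r l)" if "r > 0"
  proof -
    have "l r > 0" using assms(1)[of r] Suc.prems by simp
    moreover have "last (pos_list r l) = (r - 1, l (r - 1) - 1)"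
      using pos_list_ends[OF that, of l] assms(1) Suc.prems by simp
    ultimately show ?thesis using that by (cases r) (simp_all add: hd_map)
  qed
  ultimately show ?case using Suc
    by (cases "r = 0") (auto simp: pos_list_Suc successively_append_iff pos_list_def)
qed

section \<open>Zigzag regions as traces\<close>

text \<open>The weight sits on the target variable only, so that around a cycle each variable
  contributes its factor exactly once.\<close>

definition rel_kernel :: "'a set \<Rightarrow> ('a \<Rightarrow> 'a \<Rightarrow> bool) \<Rightarrow> ('a \<Rightarrow> real) \<Rightarrow> 'a \<Rightarrow> 'a \<Rightarrow> ennreal" where
  "rel_kernel A R f x y = (if y \<in> A \<and> R x y then ennreal (f y) else 0)"

text \<open>Common shape of \<open>cyc_summation_set\<close>, where \<open>D\<close> is
  \<open>\<ge>\<close>, and \<open>cyc_domain\<close>, where \<open>D\<close> is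
  \<open>>\<close>.\<close>

definition zigzag ::
    "nat \<Rightarrow> (nat \<Rightarrow> nat) \<Rightarrow> 'a set \<Rightarrow> ('a \<Rightarrow> 'a \<Rightarrow> bool) \<Rightarrow> ('a \<Rightarrow> 'a \<Rightarrow> bool) \<Rightarrow> (nat \<times> nat \<Rightarrow> 'a) set" where
  "zigzag s l A U D = {t \<in> block_positions s l \<rightarrow>\<^sub>E A. \<forall>i<s.
     (\<forall>j. Suc j < l i \<longrightarrow> U (t (i, j)) (t (i, Suc j))) \<and> D (t (i, l i - 1)) (t (Suc i mod s, 0))}"

text \<open>The definition attaches each relation to its left variable; a product of kernels
  attaches it to the variable being entered. The first entry of a block is the one entered by
  \<open>D\<close>.\<close>

lemma zigzag_iff_prev_pos:
  assumes "\<And>i. i < s \<Longrightarrow> l i > 0" "t \<in> extensional (block_positions s l)"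
  shows "t \<in> zigzag s l A U D \<longleftrightarrow>
    (\<forall>p\<in>block_positions s l. t p \<in> A \<and> (if snd p = 0 then D else U) (t (prev_pos s l p)) (t p))"
    (is "?lhs \<longleftrightarrow> ?rhs")
proof
  assume lhs: ?lhs
  show ?rhs
  proof
    fix p assume p: "p \<in> block_positions s l"
    obtain i j where ij: "p = (i, j)" "i < s" "j < l i" using p by (auto simp: block_positions_def)
    have "t p \<in> A" using lhs p by (auto simp: zigzag_def)
    moreover have "(if snd p = 0 then D else U) (t (prev_pos s l p)) (t p)"
    proof (cases j)
      case 0
      have D: "D (t (i', l i' - 1)) (t (Suc i' mod s, 0))" if "i' < s" for i'
        using lhs that by (auto simp: zigzag_def)
      show ?thesis
      proof (cases i)
        case i0: 0
        then show ?thesis using D[of "s - 1"] ij 0 by simp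
      next
        case (Suc i')
        then show ?thesis using D[of i'] ij 0 by simp
      qed
    next
      case (Suc j')
      then show ?thesis using lhs ij by (auto simp: zigzag_def)
    qed
    ultimately show "t p \<in> A \<and> (if snd p = 0 then D else U) (t (prev_pos s l p)) (t p)" by blast
  qed
next
  assume rhs: ?rhs
  have "U (t (i, j)) (t (i, Suc j))" if "i < s" "Suc j < l i" for i j
    using rhs[rule_format, of "(i, Suc j)"] that by (auto simp: block_positions_def)
  moreover have "D (t (i, l i - 1)) (t (Suc i mod s, 0))" if i: "i < s" for i
  proof -
    have "(Suc i mod s, 0) \<in> block_positions s l"
      using assms(1)[of "Suc i mod s"] i by (auto simp: block_positions_def)
    from rhs[rule_format, OF this] have "D (t (prev_pos s l (Suc i mod s, 0))) (t (Suc i mod s, 0))"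
      by simp
    moreover have "prev_pos s l (Suc i mod s, 0) = (i, l i - 1)"
    proof (cases "Suc i = s")
      case True
      then show ?thesis by auto
    next
      case False
      then show ?thesis using i by simp
    qed
    ultimately show ?thesis by simp
  qed
  ultimately show ?lhs using rhs assms(2) by (auto simp: zigzag_def PiE_def)
qed

text \<open>Both the weight and the indicator of the region factor over the positions; off the
  region some kernel factor is zero.\<close>

lemma (in sigma_finite_measure) nn_integral_zigzag:
  assumes "s > 0" "\<And>i. i < s \<Longrightarrow> l i > 0"
    and nonneg: "\<And>p y. y \<in> A \<Longrightarrow> 0 \<le> f p y"
    and meas: "\<And>p. p \<in> block_positions s l \<Longrightarrow> kernel_on M (rel_kernel A (if snd p = 0 then D else U) (f p))"
  defines "w \<equiv> \<lambda>t. ennreal (\<Prod>i<s. \<Prod>j<l i. f (i, j) (t (i, j))) * indicator (zigzag s l A U D) t"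
  shows "w \<in> borel_measurable (Pi\<^sub>M (block_positions s l) (\<lambda>_. M))"
    and "(\<integral>\<^sup>+t. w t \<partial>Pi\<^sub>M (block_positions s l) (\<lambda>_. M))
    = kern_trace M (map (\<lambda>p. rel_kernel A (if snd p = 0 then D else U) (f p)) (pos_list s l))"
proof -
  define L where "L = (\<lambda>p. rel_kernel A (if snd p = 0 then D else U) (f p))"
  have fin: "finite (block_positions s l)" by (simp add: block_positions_def)
  have eq: "w t = (\<Prod>p\<in>block_positions s l. L p (t (prev_pos s l p)) (t p))"
    if "t \<in> space (Pi\<^sub>M (block_positions s l) (\<lambda>_. M))" for t
  proof -
    have t: "t \<in> extensional (block_positions s l)" using that by (auto simp: space_PiM PiE_def)
    note iff = zigzag_iff_prev_pos[OF assms(2) t, of A U D]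
    have double: "(\<Prod>i<s. \<Prod>j<l i. f (i, j) (t (i, j))) = (\<Prod>p\<in>block_positions s l. f p (t p))"
      by (simp add: block_positions_def prod.Sigma)
    show ?thesis
    proof (cases "t \<in> zigzag s l A U D")
      case True
      have "L p (t (prev_pos s l p)) (t p) = ennreal (f p (t p)) \<and> 0 \<le> f p (t p)"
        if p: "p \<in> block_positions s l" for p
      proof -
        have "t p \<in> A \<and> (if snd p = 0 then D else U) (t (prev_pos s l p)) (t p)"
          using True p iff by blast
        then show ?thesis using nonneg by (simp only: L_def rel_kernel_def if_True simp_thms)
      qed
      then show ?thesis using True by (simp add: w_def double prod_ennreal)
    next
      case False
      then obtain p where p: "p \<in> block_positions s l"
        "\<not> (t p \<in> A \<and> (if snd p = 0 then D else U) (t (prev_pos s l p)) (t p))"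
        using iff by blast
      then have "L p (t (prev_pos s l p)) (t p) = 0"
        by (simp only: L_def rel_kernel_def if_False)
      then have "(\<Prod>p\<in>block_positions s l. L p (t (prev_pos s l p)) (t p)) = 0"
        using p(1) by (intro prod_zero fin) auto
      then show ?thesis using False by (simp add: w_def)
    qed
  qed
  note cyc = nn_integral_cyclic_prod[of "pos_list s l" L "prev_pos s l"]
  have "(\<lambda>t. \<Prod>p\<in>block_positions s l. L p (t (prev_pos s l p)) (t p))
      \<in> borel_measurable (Pi\<^sub>M (block_positions s l) (\<lambda>_. M))"
    using cyc(1) pos_list_ends[of s l] assms(1,2) meas
    by (simp add: set_pos_list distinct_pos_list successively_pos_list L_def)
  then show "w \<in> borel_measurable (Pi\<^sub>M (block_positions s l) (\<lambda>_. M))"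
    using eq by (simp cong: measurable_cong)
  have "(\<integral>\<^sup>+t. w t \<partial>Pi\<^sub>M (block_positions s l) (\<lambda>_. M))
    = (\<integral>\<^sup>+t. (\<Prod>p\<in>block_positions s l. L p (t (prev_pos s l p)) (t p))
      \<partial>Pi\<^sub>M (block_positions s l) (\<lambda>_. M))"
    by (rule nn_integral_cong) (rule eq)
  also have "\<dots> = kern_trace M (map L (pos_list s l))"
    using cyc(2) pos_list_ends[of s l] assms(1,2) meas
    by (simp add: set_pos_list distinct_pos_list successively_pos_list L_def)
  finally show "(\<integral>\<^sup>+t. w t \<partial>Pi\<^sub>M (block_positions s l) (\<lambda>_. M))
    = kern_trace M (map (\<lambda>p. rel_kernel A (if snd p = 0 then D else U) (f p)) (pos_list s l))"
    by (simp add: L_def)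
qed

section \<open>Moments of iterated integrals\<close>

text \<open>
  A letter \<open>(d, k)\<close> stands for a summation variable with exponent \<open>k\<close>, reached by a descent if \<open>d\<close>
  and by an ascent otherwise; on the integral side it becomes \<open>k\<close> integration variables.
\<close>

definition sum_kernel :: "bool \<times> nat \<Rightarrow> nat \<Rightarrow> nat \<Rightarrow> ennreal" where
  "sum_kernel c = rel_kernel {1..} (if fst c then (\<ge>) else (<)) (\<lambda>m. 1 / real m ^ snd c)"

lemma sum_kernel_apply:
  "sum_kernel (d, k) n m = (if 1 \<le> m \<and> (if d then m \<le> n else n < m) then ennreal (1 / real m ^ k) else 0)"
  by (simp add: sum_kernel_def rel_kernel_def)

definition up_kernel :: "real \<Rightarrow> real \<Rightarrow> ennreal" where
  "up_kernel = rel_kernel {0<..<1} (<) (\<lambda>t. 1 / t)"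

definition int_kernels :: "bool \<times> nat \<Rightarrow> (real \<Rightarrow> real \<Rightarrow> ennreal) list" where
  "int_kernels c = rel_kernel {0<..<1} (if fst c then (>) else (<)) (\<lambda>t. 1 / (1 - t))
     # replicate (snd c - 1) up_kernel"

lemma kernel_on_count_space:
  assumes "countable A"
  shows "kernel_on (count_space A) k"
  using assms by (simp add: kernel_on_def pair_measure_countable)

lemma sigma_finite_count_nat: "sigma_finite_measure (count_space {1::nat..})"
  by (rule sigma_finite_measure_count_space_countable) simp

lemma kernel_on_lborel_rel_kernel:
  fixes f :: "real \<Rightarrow> real"
  assumes [measurable]: "f \<in> borel_measurable borel" "Measurable.pred (lborel \<Otimes>\<^sub>M lborel) (\<lambda>(x, y). R x y)"
  shows "kernel_on lborel (rel_kernel {0<..<1} R f)"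
proof -
  have [measurable]: "Measurable.pred (lborel \<Otimes>\<^sub>M lborel) (\<lambda>p. R (fst p) (snd p))"
    using assms(2) by (simp add: case_prod_beta')
  have "(\<lambda>p. rel_kernel {0<..<1} R f (fst p) (snd p)) \<in> borel_measurable (lborel \<Otimes>\<^sub>M lborel)"
    unfolding rel_kernel_def by measurable
  then show ?thesis by (simp add: kernel_on_def case_prod_beta')
qed

lemma pred_less_lborel:
  "Measurable.pred (lborel \<Otimes>\<^sub>M lborel) (\<lambda>(x, y). (x :: real) < y)"
  "Measurable.pred (lborel \<Otimes>\<^sub>M lborel) (\<lambda>(x, y). (x :: real) > y)"
  by measurable

lemma kernel_on_up_kernel: "kernel_on lborel up_kernel"
  unfolding up_kernel_def by (rule kernel_on_lborel_rel_kernel[OF _ pred_less_lborel(1)]) measurable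

lemma kernel_on_int_head:
  "kernel_on lborel (rel_kernel {0<..<1} (if d then (>) else (<)) (\<lambda>t. 1 / (1 - t)))"
  using kernel_on_lborel_rel_kernel[OF _ pred_less_lborel(1), of "\<lambda>t. 1 / (1 - t)"]
    kernel_on_lborel_rel_kernel[OF _ pred_less_lborel(2), of "\<lambda>t. 1 / (1 - t)"] by simp

lemma kernel_on_int_kernels: "k \<in> set (int_kernels c) \<Longrightarrow> kernel_on lborel k"
  by (auto simp: int_kernels_def kernel_on_up_kernel kernel_on_int_head split del: if_split)

section \<open>Integrating out the first variable\<close>

text \<open>The first variable carries the weight \<open>g\<close>, the others the kernels. Powers
  are the useful weights, since every kernel turns a power into a multiple or a sum of
  powers.\<close>

definition moment :: "(real \<Rightarrow> real \<Rightarrow> ennreal) list \<Rightarrow> (real \<Rightarrow> real) \<Rightarrow> ennreal" where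
  "moment ws g = (\<integral>\<^sup>+u. ennreal (g u) * indicator {0<..<1} u * kern_chain lborel (\<lambda>_. 1) ws u \<partial>lborel)"

lemma borel_measurable_chain_lborel:
  assumes "\<And>k. k \<in> set ws \<Longrightarrow> kernel_on lborel k"
  shows "kern_chain lborel (\<lambda>_. 1) ws \<in> borel_measurable (lborel :: real measure)"
  by (rule lborel.borel_measurable_kern_chain[OF assms]) auto

lemma moment_cong: "(\<And>u. 0 < u \<Longrightarrow> u < 1 \<Longrightarrow> g u = g' u) \<Longrightarrow> moment ws g = moment ws g'"
  unfolding moment_def by (rule nn_integral_cong) (auto simp: indicator_def)

lemma moment_cmult:
  assumes "\<And>k. k \<in> set ws \<Longrightarrow> kernel_on lborel k" "g \<in> borel_measurable borel" "0 \<le> c"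
  shows "moment ws (\<lambda>u. c * g u) = ennreal c * moment ws g"
proof -
  have [measurable]: "kern_chain lborel (\<lambda>_. 1) ws \<in> borel_measurable borel"
    using borel_measurable_chain_lborel[OF assms(1), of ws] by simp
  note [measurable] = assms(2)
  show ?thesis unfolding moment_def using assms(3)
    by (subst nn_integral_cmult[symmetric]) (auto simp: ennreal_mult' mult_ac)
qed

text \<open>The weights that occur may blow up at 1, so the series is integrated termwise by Tonelli
  and not by uniform convergence.\<close>

lemma moment_series:
  assumes "\<And>k. k \<in> set ws \<Longrightarrow> kernel_on lborel k" "\<And>m. G m \<in> borel_measurable borel"
    and "\<And>u. 0 < u \<Longrightarrow> u < 1 \<Longrightarrow> ennreal (g u) = (\<integral>\<^sup>+m. ennreal (G m u) \<partial>count_space {1::nat..})"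
  shows "moment ws g = (\<integral>\<^sup>+m. moment ws (G m) \<partial>count_space {1..})"
proof -
  have [measurable]: "kern_chain lborel (\<lambda>_. 1) ws \<in> borel_measurable borel"
    using borel_measurable_chain_lborel[OF assms(1), of ws] by simp
  note [measurable] = assms(2)
  have "moment ws g = (\<integral>\<^sup>+u. (\<integral>\<^sup>+m. ennreal (G m u) * indicator {0<..<1} u
      * kern_chain lborel (\<lambda>_. 1) ws u \<partial>count_space {1..}) \<partial>lborel)"
    unfolding moment_def
  proof (rule nn_integral_cong)
    fix u :: real
    show "ennreal (g u) * indicator {0<..<1} u * kern_chain lborel (\<lambda>_. 1) ws u
      = (\<integral>\<^sup>+m. ennreal (G m u) * indicator {0<..<1} u * kern_chain lborel (\<lambda>_. 1) ws u \<partial>count_space {1..})"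
      using assms(3)[of u] by (cases "u \<in> {0<..<1}") (auto simp: nn_integral_multc)
  qed
  also have "\<dots> = (\<integral>\<^sup>+m. moment ws (G m) \<partial>count_space {1..})"
    unfolding moment_def
    by (rule nn_integral_count_space_nn_integral) auto
  finally show ?thesis .
qed

text \<open>Integrating out the first variable \<open>t\<close> before the second variable
  \<open>u\<close> leaves an integral of the same kind with one kernel less: \<open>J\<close> is the
  integral of \<open>g\<close> over all \<open>t\<close> related to \<open>u\<close>, and it joins
  the factor \<open>f\<close> in the new weight.\<close>

lemma moment_rel_kernel:
  fixes f :: "real \<Rightarrow> real"
  assumes ws: "\<And>k. k \<in> set ws \<Longrightarrow> kernel_on lborel k"
    and f[measurable]: "f \<in> borel_measurable borel" and f0: "\<And>u. 0 < u \<Longrightarrow> u < 1 \<Longrightarrow> 0 \<le> f u"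
    and R: "Measurable.pred (lborel \<Otimes>\<^sub>M lborel) (\<lambda>(x, y). R x y)"
    and g[measurable]: "g \<in> borel_measurable borel"
    and I: "\<And>u. 0 < u \<Longrightarrow> u < 1 \<Longrightarrow>
      (\<integral>\<^sup>+t. ennreal (g t) * indicator {t. 0 < t \<and> t < 1 \<and> R t u} t \<partial>lborel) = ennreal (J u)"
  shows "moment (rel_kernel {0<..<1} R f # ws) g = moment ws (\<lambda>u. f u * J u)"
proof -
  have [measurable]: "kern_chain lborel (\<lambda>_. 1) ws \<in> borel_measurable borel"
    using borel_measurable_chain_lborel[OF ws, of ws] by simp
  have k: "kernel_on lborel (rel_kernel {0<..<1} R f)" by (rule kernel_on_lborel_rel_kernel[OF f R])
  have [measurable]: "(\<lambda>p. rel_kernel {0<..<1} R f (fst p) (snd p)) \<in> borel_measurable (lborel \<Otimes>\<^sub>M lborel)"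
    using k by (simp add: kernel_on_def case_prod_beta')
  let ?c = "kern_chain lborel (\<lambda>_. 1) ws"
  have sec[measurable]: "(\<lambda>t. rel_kernel {0<..<1} R f t u) \<in> borel_measurable borel"
     "(\<lambda>t. rel_kernel {0<..<1} R f u t) \<in> borel_measurable borel" for u
    using kernel_on_compose[OF k, of "\<lambda>t. t" borel "\<lambda>_. u"]
      kernel_on_compose[OF k, of "\<lambda>_. u" borel "\<lambda>t. t"] by auto
  have m: "(\<lambda>(t, u). ennreal (g t) * indicator {0<..<1} t * (rel_kernel {0<..<1} R f t u * ?c u))
      \<in> borel_measurable (lborel \<Otimes>\<^sub>M lborel)"
    by (simp add: case_prod_beta') measurable
  have "moment (rel_kernel {0<..<1} R f # ws) g
      = (\<integral>\<^sup>+t. (\<integral>\<^sup>+u. ennreal (g t) * indicator {0<..<1} t * (rel_kernel {0<..<1} R f t u * ?c u) \<partial>lborel) \<partial>lborel)"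
    unfolding moment_def by (simp add: nn_integral_cmult)
  also have "\<dots> = (\<integral>\<^sup>+u. (\<integral>\<^sup>+t. ennreal (g t) * indicator {0<..<1} t * (rel_kernel {0<..<1} R f t u * ?c u) \<partial>lborel) \<partial>lborel)"
    by (rule lborel_pair.Fubini'[OF m, symmetric])
  also have "\<dots> = moment ws (\<lambda>u. f u * J u)"
    unfolding moment_def
  proof (rule nn_integral_cong)
    fix u :: real
    show "(\<integral>\<^sup>+t. ennreal (g t) * indicator {0<..<1} t * (rel_kernel {0<..<1} R f t u * ?c u) \<partial>lborel)
      = ennreal (f u * J u) * indicator {0<..<1} u * ?c u"
    proof (cases "0 < u \<and> u < 1")
      case True
      have Ru: "Measurable.pred borel (\<lambda>t. R t u)"
      proof -
        have "Measurable.pred borel (\<lambda>t. (\<lambda>(x, y). R x y) (t, u))"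
          by (rule measurable_compose[OF _ R]) auto
        then show ?thesis by simp
      qed
      note [measurable] = Ru
      have "(\<integral>\<^sup>+t. ennreal (g t) * indicator {0<..<1} t * (rel_kernel {0<..<1} R f t u * ?c u) \<partial>lborel)
        = (\<integral>\<^sup>+t. (ennreal (f u) * ?c u) * (ennreal (g t) * indicator {t. 0 < t \<and> t < 1 \<and> R t u} t) \<partial>lborel)"
        by (rule nn_integral_cong) (use True in \<open>auto simp: rel_kernel_def indicator_def mult_ac\<close>)
      also have "\<dots> = (ennreal (f u) * ?c u) * ennreal (J u)"
        using True by (subst nn_integral_cmult) (auto simp: I)
      also have "\<dots> = ennreal (f u * J u) * ?c u"
        using ennreal_mult'[of "f u" "J u"] True f0[of u] by (simp add: mult_ac)
      finally show ?thesis using True by simp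
    qed (auto simp: rel_kernel_def)
  qed
  finally show ?thesis .
qed

lemma nn_integral_power_Ioo:
  assumes "0 \<le> a" "a \<le> b" "n > 0"
  shows "(\<integral>\<^sup>+t. ennreal (t ^ (n - 1)) * indicator {a<..<b} t \<partial>lborel) = ennreal ((b ^ n - a ^ n) / n)"
proof -
  have "(\<integral>\<^sup>+t. ennreal (t ^ (n - 1)) * indicator {a<..<b} t \<partial>lborel)
      = (\<integral>\<^sup>+t. ennreal (t ^ (n - 1)) * indicator {a..b} t \<partial>lborel)"
    using AE_lborel_singleton[of a] AE_lborel_singleton[of b]
    by (intro nn_integral_cong_AE) (auto simp: indicator_def)
  also have "\<dots> = ennreal (b ^ n / n - a ^ n / n)"
    using assms by (intro nn_integral_FTC_Icc) (auto intro!: derivative_eq_intros)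
  finally show ?thesis by (simp add: diff_divide_distrib)
qed

lemma moment_Nil_power:
  assumes "n > 0"
  shows "moment [] (\<lambda>t. t ^ (n - 1)) = ennreal (1 / n)"
  using nn_integral_power_Ioo[of 0 1 n] assms by (simp add: moment_def zero_power)

lemma moment_up:
  assumes "\<And>k. k \<in> set ws \<Longrightarrow> kernel_on lborel k" "f \<in> borel_measurable borel"
    "\<And>u. 0 < u \<Longrightarrow> u < 1 \<Longrightarrow> 0 \<le> f u" "n > 0"
  shows "moment (rel_kernel {0<..<1} (<) f # ws) (\<lambda>t. t ^ (n - 1)) = moment ws (\<lambda>u. f u * (u ^ n / n))"
proof (rule moment_rel_kernel[OF assms(1-3) pred_less_lborel(1)])
  fix u :: real assume u: "0 < u" "u < 1"
  then have "{t. 0 < t \<and> t < 1 \<and> t < u} = {0<..<u}" by auto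
  then show "(\<integral>\<^sup>+t. ennreal (t ^ (n - 1)) * indicator {t. 0 < t \<and> t < 1 \<and> t < u} t \<partial>lborel) = ennreal (u ^ n / n)"
    using nn_integral_power_Ioo[of 0 u n] u assms(4) by (simp add: zero_power)
qed auto

text \<open>In a descent the first variable ranges over the interval from \<open>u\<close> to 1,
  which replaces the \<open>u ^ n\<close> of an ascent by \<open>1 - u ^ n\<close>.\<close>

lemma moment_down:
  assumes "\<And>k. k \<in> set ws \<Longrightarrow> kernel_on lborel k" "f \<in> borel_measurable borel"
    "\<And>u. 0 < u \<Longrightarrow> u < 1 \<Longrightarrow> 0 \<le> f u" "n > 0"
  shows "moment (rel_kernel {0<..<1} (>) f # ws) (\<lambda>t. t ^ (n - 1)) = moment ws (\<lambda>u. f u * ((1 - u ^ n) / n))"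
proof (rule moment_rel_kernel[OF assms(1-3) pred_less_lborel(2)])
  fix u :: real assume u: "0 < u" "u < 1"
  then have "{t. 0 < t \<and> t < 1 \<and> u < t} = {u<..<1}" by auto
  then show "(\<integral>\<^sup>+t. ennreal (t ^ (n - 1)) * indicator {t. 0 < t \<and> t < 1 \<and> u < t} t \<partial>lborel) = ennreal ((1 - u ^ n) / n)"
    using nn_integral_power_Ioo[of u 1 n] u assms(4) by simp
qed auto

text \<open>Integrating \<open>t ^ (n - 1)\<close> up to \<open>u\<close> and dividing by
  \<open>u\<close> gives back \<open>u ^ (n - 1)\<close> with a factor \<open>1 / n\<close>.\<close>

lemma moment_replicate_up:
  assumes "\<And>k. k \<in> set ws \<Longrightarrow> kernel_on lborel k" "n > 0"
  shows "moment (replicate j up_kernel @ ws) (\<lambda>t. t ^ (n - 1)) = ennreal (1 / real n ^ j) * moment ws (\<lambda>t. t ^ (n - 1))"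
proof (induction j)
  case (Suc j)
  have k: "\<And>k. k \<in> set (replicate j up_kernel @ ws) \<Longrightarrow> kernel_on lborel k"
    using assms(1) by (auto simp: kernel_on_up_kernel)
  have "moment (replicate (Suc j) up_kernel @ ws) (\<lambda>t. t ^ (n - 1))
      = moment (replicate j up_kernel @ ws) (\<lambda>u. 1 / u * (u ^ n / n))"
    using moment_up[OF k, of "replicate j up_kernel @ ws" "\<lambda>u. 1 / u" n] assms(2) by (simp add: up_kernel_def)
  also have "\<dots> = moment (replicate j up_kernel @ ws) (\<lambda>u. 1 / n * u ^ (n - 1))"
    using assms(2) by (intro moment_cong) (auto simp: power_eq_if)
  also have "\<dots> = ennreal (1 / n) * moment (replicate j up_kernel @ ws) (\<lambda>u. u ^ (n - 1))"
    by (rule moment_cmult[OF k]) auto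
  also have "\<dots> = ennreal (1 / n) * ennreal (1 / real n ^ j) * moment ws (\<lambda>u. u ^ (n - 1))"
    by (simp only: Suc mult.assoc)
  finally show ?case by (simp add: ennreal_mult'[symmetric])
qed simp

section \<open>Geometric series and the passage from integrals to sums\<close>

text \<open>Series start at 0 and the measure at 1, hence the condition on
  \<open>f 0\<close>.\<close>

lemma nn_integral_count_space_sums:
  assumes "\<And>m. 0 \<le> f m" "f 0 = 0" "f sums x"
  shows "(\<integral>\<^sup>+m. ennreal (f m) \<partial>count_space {1::nat..}) = ennreal x"
proof -
  have "(\<integral>\<^sup>+m. ennreal (f m) \<partial>count_space {1::nat..})
      = (\<integral>\<^sup>+m. ennreal (f m) * indicator {1..} m \<partial>count_space UNIV)"
    by (simp add: nn_integral_count_space_indicator)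
  also have "\<dots> = (\<integral>\<^sup>+m. ennreal (f m) \<partial>count_space UNIV)"
  proof (rule nn_integral_cong)
    fix m show "ennreal (f m) * indicator {1..} m = ennreal (f m)"
      using assms(2) by (cases "m = 0") (auto simp: indicator_def)
  qed
  also have "\<dots> = ennreal x"
    using suminf_ennreal_eq[OF assms(1,3)] by (simp add: nn_integral_count_space_nat)
  finally show ?thesis .
qed

text \<open>The geometric series from the power \<open>u ^ n\<close> on. It turns an ascent of
  integration variables into the strict inequality between summation variables.\<close>

lemma geometric_tail:
  fixes u c :: real
  assumes "0 < u" "u < 1" "0 \<le> c"
  shows "(\<integral>\<^sup>+m. ennreal (if n < m then c * u ^ (m - 1) else 0) \<partial>count_space {1::nat..})
      = ennreal (c * u ^ n / (1 - u))"
proof (rule nn_integral_count_space_sums)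
  have "(\<lambda>i. c * u ^ n * u ^ i) sums (c * u ^ n * (1 / (1 - u)))"
    using assms by (intro sums_mult geometric_sums) auto
  then have "(\<lambda>i. if n < i + Suc n then c * u ^ (i + Suc n - 1) else 0) sums (c * u ^ n / (1 - u))"
    by (simp add: power_add mult_ac)
  then show "(\<lambda>m. if n < m then c * u ^ (m - 1) else 0) sums (c * u ^ n / (1 - u))"
    by (subst (asm) sums_iff_shift) (simp add: sum.neutral)
qed (use assms in auto)

text \<open>The finite geometric sum with \<open>n\<close> terms. It includes \<open>m = n\<close>,
  which is why a descent \<open>>\<close> in the integral corresponds to \<open>\<ge>\<close> in the
  sum.\<close>

lemma geometric_init:
  fixes u c :: real
  assumes "0 < u" "u < 1" "0 \<le> c"
  shows "(\<integral>\<^sup>+m. ennreal (if m \<in> {1..n} then c * u ^ (m - 1) else 0) \<partial>count_space {1::nat..})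
      = ennreal (c * (1 - u ^ n) / (1 - u))"
proof (rule nn_integral_count_space_sums)
  have "(\<Sum>m\<in>{1..n}. c * u ^ (m - 1)) = c * (1 - u ^ n) / (1 - u)"
  proof (induction n)
    case (Suc n)
    have "(\<Sum>m\<in>{1..Suc n}. c * u ^ (m - 1)) = c * (1 - u ^ n) / (1 - u) + c * u ^ n"
      using Suc by simp
    also have "\<dots> = c * (1 - u ^ Suc n) / (1 - u)"
      using assms by (simp add: field_simps)
    finally show ?case .
  qed simp
  then show "(\<lambda>m. if m \<in> {1..n} then c * u ^ (m - 1) else 0) sums (c * (1 - u ^ n) / (1 - u))"
    using sums_If_finite_set[of "{1..n}" "\<lambda>m. c * u ^ (m - 1)"] by simp
qed (use assms in auto)

text \<open>The factor \<open>1 / n\<close> comes from integrating the power, the sum over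
  \<open>m\<close> from expanding \<open>1 / (1 - u)\<close>, and the exponent \<open>k - 1\<close>
  from the remaining forms \<open>dt / t\<close>. One power of \<open>1 / m\<close> is still
  missing; the next integration supplies it.\<close>

lemma moment_letter:
  assumes ws: "\<And>k. k \<in> set ws \<Longrightarrow> kernel_on lborel k" and "n > 0" "k > 0"
  shows "moment (int_kernels (d, k) @ ws) (\<lambda>t. t ^ (n - 1))
    = ennreal (1 / n) * (\<integral>\<^sup>+m. (if (if d then m \<le> n else n < m) then ennreal (1 / real m ^ (k - 1))
         * moment ws (\<lambda>t. t ^ (m - 1)) else 0) \<partial>count_space {1..})"
proof -
  let ?vs = "replicate (k - 1) up_kernel @ ws"
  have vs: "\<And>k. k \<in> set ?vs \<Longrightarrow> kernel_on lborel k"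
    using ws by (auto simp: kernel_on_up_kernel)
  let ?P = "\<lambda>m. if d then m \<le> n else n < m"
  let ?G = "\<lambda>m u. if ?P m then 1 / n * u ^ (m - 1) else 0 :: real"
  have "moment (int_kernels (d, k) @ ws) (\<lambda>t. t ^ (n - 1))
      = moment ?vs (\<lambda>u. 1 / (1 - u) * ((if d then 1 - u ^ n else u ^ n) / n))"
    using moment_up[OF vs, of ?vs "\<lambda>t. 1 / (1 - t)" n] moment_down[OF vs, of ?vs "\<lambda>t. 1 / (1 - t)" n] assms
    by (simp add: int_kernels_def)
  also have "\<dots> = (\<integral>\<^sup>+m. moment ?vs (?G m) \<partial>count_space {1..})"
  proof (rule moment_series[OF vs])
    fix u :: real assume u: "0 < u" "u < 1"
    show "ennreal (1 / (1 - u) * ((if d then 1 - u ^ n else u ^ n) / n))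
      = (\<integral>\<^sup>+m. ennreal (?G m u) \<partial>count_space {1..})"
    proof (cases d)
      case True
      have "(\<integral>\<^sup>+m. ennreal (?G m u) \<partial>count_space {1..})
        = (\<integral>\<^sup>+m. ennreal (if m \<in> {1..n} then 1 / n * u ^ (m - 1) else 0) \<partial>count_space {1::nat..})"
        by (rule nn_integral_cong) (use True in auto)
      then show ?thesis using geometric_init[OF u, of "1 / n" n] True by (simp add: mult.commute)
    next
      case False
      then show ?thesis using geometric_tail[OF u, of "1 / n" n] by (simp add: mult.commute)
    qed
  qed auto
  also have "\<dots> = (\<integral>\<^sup>+m. ennreal (1 / n) * (if ?P m then ennreal (1 / real m ^ (k - 1))
         * moment ws (\<lambda>t. t ^ (m - 1)) else 0) \<partial>count_space {1..})"
  proof (rule nn_integral_cong)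
    fix m :: nat assume "m \<in> space (count_space {1..})"
    then have m: "m > 0" by simp
    show "moment ?vs (?G m) = ennreal (1 / n) * (if ?P m then ennreal (1 / real m ^ (k - 1))
         * moment ws (\<lambda>t. t ^ (m - 1)) else 0)"
    proof (cases "?P m")
      case True
      then have "moment ?vs (?G m) = moment ?vs (\<lambda>u. 1 / n * u ^ (m - 1))" by simp
      also have "\<dots> = ennreal (1 / n) * moment ?vs (\<lambda>u. u ^ (m - 1))"
        by (rule moment_cmult[OF vs]) auto
      finally show ?thesis using True moment_replicate_up[OF ws m, of ws "k - 1"] by simp
    qed (simp add: moment_def)
  qed
  also have "\<dots> = ennreal (1 / n) * (\<integral>\<^sup>+m. (if ?P m then ennreal (1 / real m ^ (k - 1))
         * moment ws (\<lambda>t. t ^ (m - 1)) else 0) \<partial>count_space {1..})"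
    by (rule nn_integral_cmult) simp
  finally show ?thesis .
qed

text \<open>In the induction the prefactor, taken at the value \<open>m\<close> of the current
  letter, is the power that completes the exponent \<open>k - 1\<close> of
  \<open>moment_letter\<close> to \<open>k\<close>.\<close>

lemma moment_eq_sum_chain:
  assumes "\<And>c. c \<in> set cs \<Longrightarrow> snd c > 0" "n > 0"
  shows "moment (concat (map int_kernels cs)) (\<lambda>t. t ^ (n - 1))
    = ennreal (1 / n) * kern_chain (count_space {1..}) (\<lambda>_. 1) (map sum_kernel cs) n"
  using assms
proof (induction cs arbitrary: n)
  case Nil
  then show ?case using moment_Nil_power[of n] by simp
next
  case (Cons c cs)
  obtain d k where c: "c = (d, k)" by (cases c)
  have k: "k > 0" using Cons.prems(1)[of c] c by simp
  let ?ch = "kern_chain (count_space {1..}) (\<lambda>_. 1) (map sum_kernel cs)"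
  have "moment (concat (map int_kernels (c # cs))) (\<lambda>t. t ^ (n - 1))
    = ennreal (1 / n) * (\<integral>\<^sup>+m. (if (if d then m \<le> n else n < m) then ennreal (1 / real m ^ (k - 1))
         * moment (concat (map int_kernels cs)) (\<lambda>t. t ^ (m - 1)) else 0) \<partial>count_space {1..})"
    unfolding c list.map concat.simps
    by (rule moment_letter) (use Cons.prems(2) k kernel_on_int_kernels in auto)
  also have "(\<integral>\<^sup>+m. (if (if d then m \<le> n else n < m) then ennreal (1 / real m ^ (k - 1))
         * moment (concat (map int_kernels cs)) (\<lambda>t. t ^ (m - 1)) else 0) \<partial>count_space {1..})
     = (\<integral>\<^sup>+m. sum_kernel c n m * ?ch m \<partial>count_space {1..})"
  proof (rule nn_integral_cong)
    fix m :: nat assume "m \<in> space (count_space {1..})"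
    then have m: "m > 0" by simp
    have "ennreal (1 / real m ^ (k - 1)) * moment (concat (map int_kernels cs)) (\<lambda>t. t ^ (m - 1))
        = ennreal (1 / real m ^ (k - 1)) * ennreal (1 / m) * ?ch m"
      using Cons.IH[of m] Cons.prems m by (simp add: mult.assoc)
    also have "ennreal (1 / real m ^ (k - 1)) * ennreal (1 / m) = ennreal (1 / real m ^ k)"
      using k m by (cases k) (simp_all add: ennreal_mult'[symmetric] mult.commute)
    finally show "(if (if d then m \<le> n else n < m) then ennreal (1 / real m ^ (k - 1))
         * moment (concat (map int_kernels cs)) (\<lambda>t. t ^ (m - 1)) else 0) = sum_kernel c n m * ?ch m"
      using m by (auto simp: sum_kernel_apply c)
  qed
  finally show ?case by simp
qed

text \<open>With no condition on entering the first variable, \<open>1 / (1 - u)\<close> expands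
  into all powers \<open>u ^ (m - 1)\<close>, and each of them gives a moment of the remaining
  kernels.\<close>

lemma free_trace_eq:
  assumes "\<And>c. c \<in> set cs \<Longrightarrow> snd c > 0" "k > 0"
  shows "kern_trace lborel ((\<lambda>_. \<lambda>u. ennreal (1 / (1 - u)) * indicator {0<..<1} u)
        # replicate (k - 1) up_kernel @ concat (map int_kernels cs))
    = kern_trace (count_space {1..}) ((\<lambda>_. \<lambda>m. ennreal (1 / real m ^ k)) # map sum_kernel cs)"
proof -
  interpret N: sigma_finite_measure "count_space {1::nat..}" by (rule sigma_finite_count_nat)
  let ?ws = "concat (map int_kernels cs)" and ?vs = "replicate (k - 1) up_kernel @ concat (map int_kernels cs)"
  let ?ch = "kern_chain (count_space {1..}) (\<lambda>_. 1) (map sum_kernel cs)"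
  have ws: "\<And>k. k \<in> set ?ws \<Longrightarrow> kernel_on lborel k" by (auto simp: kernel_on_int_kernels)
  then have vs: "\<And>k. k \<in> set ?vs \<Longrightarrow> kernel_on lborel k" by (auto simp: kernel_on_up_kernel)
  have "kern_trace lborel ((\<lambda>_. \<lambda>u. ennreal (1 / (1 - u)) * indicator {0<..<1} u) # ?vs)
      = moment ?vs (\<lambda>u. 1 / (1 - u))"
    unfolding moment_def by (rule lborel.kern_trace_free[OF vs])
  also have "\<dots> = (\<integral>\<^sup>+m. moment ?vs (\<lambda>u. u ^ (m - 1)) \<partial>count_space {1..})"
  proof (rule moment_series[OF vs])
    fix u :: real assume u: "0 < u" "u < 1"
    have "(\<integral>\<^sup>+m. ennreal (u ^ (m - 1)) \<partial>count_space {1::nat..})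
        = (\<integral>\<^sup>+m. ennreal (if 0 < m then 1 * u ^ (m - 1) else 0) \<partial>count_space {1::nat..})"
      by (rule nn_integral_cong) auto
    then show "ennreal (1 / (1 - u)) = (\<integral>\<^sup>+m. ennreal (u ^ (m - 1)) \<partial>count_space {1::nat..})"
      using geometric_tail[OF u, of 1 0] by simp
  qed auto
  also have "\<dots> = (\<integral>\<^sup>+m. ennreal (1 / real m ^ k) * ?ch m \<partial>count_space {1..})"
  proof (rule nn_integral_cong)
    fix m :: nat assume "m \<in> space (count_space {1..})"
    then have m: "m > 0" by simp
    have "moment ?vs (\<lambda>u. u ^ (m - 1)) = ennreal (1 / real m ^ (k - 1)) * ennreal (1 / m) * ?ch m"
      using moment_replicate_up[OF ws m, of ?ws "k - 1"] moment_eq_sum_chain[OF assms(1) m, of cs] by (simp add: mult.assoc)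
    also have "ennreal (1 / real m ^ (k - 1)) * ennreal (1 / m) = ennreal (1 / real m ^ k)"
      using assms(2) m by (cases k) (simp_all add: ennreal_mult'[symmetric] mult.commute)
    finally show "moment ?vs (\<lambda>u. u ^ (m - 1)) = ennreal (1 / real m ^ k) * ?ch m" .
  qed
  also have "\<dots> = kern_trace (count_space {1..}) ((\<lambda>_. \<lambda>m. ennreal (1 / real m ^ k)) # map sum_kernel cs)"
    by (rule N.kern_trace_free[symmetric]) (simp add: kernel_on_count_space)
  finally show ?thesis .
qed

section \<open>Convergence\<close>

abbreviation sum_chain :: "(bool \<times> nat) list \<Rightarrow> nat \<Rightarrow> ennreal" where
  "sum_chain cs \<equiv> kern_chain (count_space {1..}) (\<lambda>_. 1) (map sum_kernel cs)"

text \<open>Each block is entered by a descent, cyclically also the first one.\<close>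

definition block_word :: "nat list \<Rightarrow> (bool \<times> nat) list" where
  "block_word ks = (True, hd ks) # map (Pair False) (tl ks)"

text \<open>Discrete forms of the integrals of \<open>x powr (-3/2)\<close> and
  \<open>x powr (-1/2)\<close> over a unit interval, for \<open>a\<close> and \<open>b\<close> the
  square roots of consecutive integers. Both rest on \<open>(b - a) * (a + b) = 1\<close>.\<close>

lemma inverse_sqrt_tail:
  fixes a b :: real
  assumes "0 < a" "0 \<le> b" "b\<^sup>2 = a\<^sup>2 + 1"
  shows "1 / b ^ 3 \<le> 2 * (1 / a - 1 / b)" "2 * a + 1 / b \<le> 2 * b"
proof -
  have ab: "a < b" using assms by (metis less_add_one power_less_imp_less_base)
  have b: "0 < b" using ab assms by simp
  have d: "(b - a) * (a + b) = 1" using assms by (simp add: power2_eq_square algebra_simps)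
  have "a * b * (a + b) \<le> b * b * (b + b)"
    using ab assms b by (intro mult_mono) auto
  then have "2 / (b * b * (b + b)) \<le> 2 / (a * b * (a + b))"
    using assms b ab by (intro divide_left_mono) auto
  also have "2 / (a * b * (a + b)) = 2 * (1 / a - 1 / b)"
    using d assms b ab by (simp add: divide_simps) (simp add: algebra_simps)
  also have "2 / (b * b * (b + b)) = 1 / b ^ 3"
    using b by (simp add: field_simps power3_eq_cube)
  finally show "1 / b ^ 3 \<le> 2 * (1 / a - 1 / b)" .
  have "1 = (b - a) * (a + b)" using d by simp
  also have "\<dots> \<le> (b - a) * (2 * b)" using ab by (intro mult_left_mono) auto
  finally show "2 * a + 1 / b \<le> 2 * b" using b by (simp add: field_simps)
qed

lemma sum_inverse_sqrt_le:
  fixes n :: nat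
  assumes C: "0 \<le> C"
  shows "(\<integral>\<^sup>+m. (if m \<le> n then ennreal (C / sqrt m) else 0) \<partial>count_space {1::nat..}) \<le> ennreal (2 * C * sqrt n)"
proof -
  have "(\<integral>\<^sup>+m. (if m \<le> n then ennreal (C / sqrt m) else 0) \<partial>count_space {1::nat..})
      = (\<integral>\<^sup>+m. ennreal (if m \<in> {1..n} then C / sqrt m else 0) \<partial>count_space {1::nat..})"
    by (rule nn_integral_cong) auto
  also have "\<dots> = ennreal (\<Sum>m\<in>{1..n}. C / sqrt m)"
    using C sums_If_finite_set[of "{1..n}" "\<lambda>m. C / sqrt m"]
    by (intro nn_integral_count_space_sums) auto
  also have "(\<Sum>m\<in>{1..n}. C / sqrt m) \<le> 2 * C * sqrt n"
  proof (induction n)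
    case (Suc n)
    have "(\<Sum>m\<in>{1..Suc n}. C / sqrt m) \<le> 2 * C * sqrt n + C / sqrt (Suc n)"
      using Suc by simp
    also have "\<dots> = C * (2 * sqrt n + 1 / sqrt (Suc n))" by (simp add: algebra_simps)
    \<comment> \<open>For \<open>n = 0\<close> this reads \<open>C \<le> 2 * C\<close> and is
      checked directly, as the estimate for square roots asks for \<open>0 < a\<close>.\<close>
    also have "\<dots> \<le> C * (2 * sqrt (Suc n))"
      using C inverse_sqrt_tail(2)[of "sqrt n" "sqrt (Suc n)"]
      by (cases "n = 0") (auto intro!: mult_left_mono)
    finally show ?case by (simp add: mult_ac)
  qed simp
  finally show ?thesis by (simp add: ennreal_leI)
qed

text \<open>The terms are dominated by the telescoping differences
  \<open>1 / sqrt (m - 1) - 1 / sqrt m\<close>, whose denominators are positive because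
  \<open>0 < n < m\<close>.\<close>

lemma sum_inverse_sqrt_tail_le:
  fixes n :: nat
  assumes "n > 0" and C: "0 \<le> C"
  shows "(\<integral>\<^sup>+m. (if n < m then ennreal (C / (m * sqrt m)) else 0) \<partial>count_space {1::nat..}) \<le> ennreal (2 * C / sqrt n)"
proof -
  let ?f = "\<lambda>m::nat. if n < m then 2 * C * (1 / sqrt (m - 1) - 1 / sqrt m) else 0"
  have f: "C / (m * sqrt m) \<le> ?f m" if "n < m" for m
  proof -
    have m: "m > 1" using that assms by simp
    have "1 / sqrt m ^ 3 \<le> 2 * (1 / sqrt (m - 1) - 1 / sqrt m)"
      using m by (intro inverse_sqrt_tail(1)) (auto simp: of_nat_diff)
    then have "C * (1 / sqrt m ^ 3) \<le> C * (2 * (1 / sqrt (m - 1) - 1 / sqrt m))"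
      using C by (rule mult_left_mono)
    then show ?thesis using that by (simp add: power3_eq_cube mult_ac)
  qed
  have "(\<integral>\<^sup>+m. (if n < m then ennreal (C / (m * sqrt m)) else 0) \<partial>count_space {1::nat..})
      \<le> (\<integral>\<^sup>+m. ennreal (?f m) \<partial>count_space {1::nat..})"
    by (rule nn_integral_mono) (use f in \<open>auto intro!: ennreal_leI\<close>)
  also have "\<dots> = ennreal (2 * C / sqrt n)"
  proof (rule nn_integral_count_space_sums)
    fix m show "0 \<le> ?f m"
    proof (cases "n < m")
      case True
      have "0 \<le> C / (m * sqrt m)" using C by simp
      also note f[OF True]
      finally show ?thesis .
    qed simp
  next
    have "(\<lambda>i. 1 / sqrt (n + real i)) \<longlonglongrightarrow> 0"
      by (intro tendsto_divide_0[OF tendsto_const] filterlim_at_top_imp_at_infinity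
          filterlim_compose[OF sqrt_at_top] filterlim_tendsto_add_at_top[OF tendsto_const]
          filterlim_real_sequentially)
    from telescope_sums'[OF this]
    have "(\<lambda>i. 2 * C * (1 / sqrt (n + real i) - 1 / sqrt (n + real (Suc i)))) sums (2 * C * (1 / sqrt n - 0))"
      by (intro sums_mult) simp
    then have "(\<lambda>i. ?f (i + Suc n)) sums (2 * C / sqrt n)"
      by (simp add: add_ac)
    then show "?f sums (2 * C / sqrt n)"
      by (subst (asm) sums_iff_shift) (simp add: sum.neutral)
  qed simp
  finally show ?thesis .
qed

lemma sum_inverse_sqrt_finite:
  "0 \<le> C \<Longrightarrow> (\<integral>\<^sup>+m. ennreal (C / (m * sqrt m)) \<partial>count_space {1::nat..}) < \<infinity>"
proof -
  assume C: "0 \<le> C"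
  have "summable (\<lambda>m. real m powr (-3/2))" by (subst summable_real_powr_iff) simp
  then have "summable (\<lambda>m. C * real m powr (-3/2))" by (rule summable_mult)
  moreover have "(\<lambda>m. C * real m powr (-3/2)) = (\<lambda>m. C / (m * sqrt m))"
  proof
    fix m :: nat
    show "C * real m powr (-3/2) = C / (m * sqrt m)"
    proof (cases "m = 0")
      case False
      have "real m powr (-3/2) = 1 / real m powr (1 + 1/2)" by (simp add: powr_minus_divide)
      also have "real m powr (1 + 1/2) = m * sqrt m" using False
        by (subst powr_add) (simp add: powr_half_sqrt)
      finally show ?thesis by simp
    qed simp
  qed
  ultimately have "summable (\<lambda>m. C / (m * sqrt m))" by (simp only:)
  from nn_integral_count_space_sums[OF _ _ summable_sums[OF this]]
  show ?thesis using C by (simp add: ennreal_less_top)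
qed

section \<open>Growth bounds for block words\<close>

text \<open>The last entry, being at least 2, turns growth \<open>sqrt n\<close> into decay
  \<open>1 / (n * sqrt n)\<close>. Going backwards, the tail sum of this decay is of order
  \<open>1 / sqrt n\<close>, and an exponent at least 1 restores the order
  \<open>1 / (n * sqrt n)\<close>, so only the constant changes.\<close>

lemma admissible_head_bound:
  assumes "admissible_index ks" "0 \<le> C" "\<And>n. n > 0 \<Longrightarrow> sum_chain cs n \<le> ennreal (C * sqrt n)"
  shows "\<exists>B\<ge>0. \<forall>n>0. ennreal (1 / real n ^ hd ks) * sum_chain (map (Pair False) (tl ks) @ cs) n
    \<le> ennreal (B / (n * sqrt n))"
  using assms(1)
proof (induction ks)
  case Nil
  then show ?case by (simp add: admissible_index_def)
next
  case (Cons k ks)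
  show ?case
  proof (cases "ks = []")
    case True
    then have k: "k \<ge> 2" using Cons.prems by (simp add: admissible_index_def)
    have "ennreal (1 / real n ^ k) * sum_chain cs n \<le> ennreal (C / (n * sqrt n))" if n: "n > 0" for n
    proof -
      have "ennreal (1 / real n ^ k) * sum_chain cs n \<le> ennreal (1 / real n ^ 2) * ennreal (C * sqrt n)"
        using n k assms(3)[OF n]
        by (intro mult_mono ennreal_leI divide_left_mono power_increasing) auto
      also have "\<dots> = ennreal (1 / real n ^ 2 * (C * sqrt n))"
        by (rule ennreal_mult'[symmetric]) simp
      also have "1 / real n ^ 2 * (C * sqrt n) = C / (n * sqrt n)"
        using n by (simp add: field_simps power2_eq_square)
      finally show ?thesis .
    qed
    then show ?thesis using True assms(2) by auto
  next
    case False
    have "admissible_index ks" using Cons.prems False by (simp add: admissible_index_def)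
    from Cons.IH[OF this] obtain B where B: "B \<ge> 0"
      "\<And>n. n > 0 \<Longrightarrow> ennreal (1 / real n ^ hd ks) * sum_chain (map (Pair False) (tl ks) @ cs) n
        \<le> ennreal (B / (n * sqrt n))" by blast
    have k: "k \<ge> 1" using Cons.prems by (simp add: admissible_index_def)
    have split: "map (Pair False) ks @ cs = (False, hd ks) # map (Pair False) (tl ks) @ cs"
      using False by (cases ks) auto
    have "ennreal (1 / real n ^ k) * sum_chain (map (Pair False) ks @ cs) n \<le> ennreal (2 * B / (n * sqrt n))"
      if n: "n > 0" for n
    proof -
      have "sum_chain (map (Pair False) ks @ cs) n
          \<le> (\<integral>\<^sup>+m. (if n < m then ennreal (B / (m * sqrt m)) else 0) \<partial>count_space {1..})"
        unfolding split list.map kern_chain.simps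
        by (rule nn_integral_mono) (use B(2) in \<open>auto simp: sum_kernel_apply\<close>)
      also have "\<dots> \<le> ennreal (2 * B / sqrt n)" by (rule sum_inverse_sqrt_tail_le[OF n B(1)])
      finally have "ennreal (1 / real n ^ k) * sum_chain (map (Pair False) ks @ cs) n
          \<le> ennreal (1 / real n ^ 1) * ennreal (2 * B / sqrt n)"
        using n k by (intro mult_mono ennreal_leI divide_left_mono power_increasing) auto
      also have "\<dots> = ennreal (1 / real n ^ 1 * (2 * B / sqrt n))"
        by (rule ennreal_mult'[symmetric]) simp
      finally show ?thesis by simp
    qed
    then show ?thesis using B(1) by (intro exI[of _ "2 * B"]) simp
  qed
qed

text \<open>The rate \<open>sqrt n\<close> is stable under every permitted block: \<open>[1]\<close>
  and admissible blocks both leave a summand bounded by a multiple of \<open>1 / sqrt m\<close>,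
  whose sum over \<open>m \<le> n\<close> is again of order \<open>sqrt n\<close>. A constant bound
  would not survive a block \<open>[1]\<close>, which produces a logarithm.\<close>

lemma sum_chain_bound:
  assumes "\<And>ks. ks \<in> set kk \<Longrightarrow> admissible_index ks \<or> ks = [1]"
  shows "\<exists>C\<ge>0. \<forall>n>0. sum_chain (concat (map block_word kk)) n \<le> ennreal (C * sqrt n)"
  using assms
proof (induction kk)
  case Nil
  show ?case by (rule exI[of _ 1]) (auto simp: Suc_le_eq)
next
  case (Cons ks kk)
  let ?cs = "concat (map block_word kk)"
  obtain C where C: "C \<ge> 0" "\<And>n. n > 0 \<Longrightarrow> sum_chain ?cs n \<le> ennreal (C * sqrt n)"
    using Cons by auto
  have "\<exists>B\<ge>0. \<forall>n>0. ennreal (1 / real n ^ hd ks) * sum_chain (map (Pair False) (tl ks) @ ?cs) n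
      \<le> ennreal (B / sqrt n)"
  proof (cases "ks = [1]")
    case True
    have "ennreal (1 / real n) * sum_chain ?cs n \<le> ennreal (C / sqrt n)" if n: "n > 0" for n
    proof -
      have "ennreal (1 / real n) * sum_chain ?cs n \<le> ennreal (1 / real n) * ennreal (C * sqrt n)"
        using C(2)[OF n] by (intro mult_left_mono) auto
      also have "\<dots> = ennreal (1 / real n * (C * sqrt n))" by (rule ennreal_mult'[symmetric]) simp
      also have "1 / real n * (C * sqrt n) = C / sqrt n" using n by (simp add: field_simps)
      finally show ?thesis .
    qed
    then show ?thesis using True C(1) by auto
  next
    case False
    then have "admissible_index ks" using Cons.prems[of ks] by simp
    from admissible_head_bound[OF this C] obtain B where B: "B \<ge> 0"
      "\<And>n. n > 0 \<Longrightarrow> ennreal (1 / real n ^ hd ks) * sum_chain (map (Pair False) (tl ks) @ ?cs) n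
        \<le> ennreal (B / (n * sqrt n))" by auto
    have "ennreal (B / (n * sqrt n)) \<le> ennreal (B / sqrt n)" if "n > 0" for n :: nat
      using that B(1) by (intro ennreal_leI divide_left_mono) auto
    then show ?thesis using B order_trans by blast
  qed
  then obtain B where B: "B \<ge> 0"
    "\<And>n. n > 0 \<Longrightarrow> ennreal (1 / real n ^ hd ks) * sum_chain (map (Pair False) (tl ks) @ ?cs) n
      \<le> ennreal (B / sqrt n)" by blast
  have split: "concat (map block_word (ks # kk)) = (True, hd ks) # map (Pair False) (tl ks) @ ?cs"
    by (simp add: block_word_def)
  have "sum_chain (concat (map block_word (ks # kk))) n \<le> ennreal (2 * B * sqrt n)" for n
  proof -
    have "sum_chain (concat (map block_word (ks # kk))) n
        \<le> (\<integral>\<^sup>+m. (if m \<le> n then ennreal (B / sqrt m) else 0) \<partial>count_space {1..})"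
      unfolding split unfolding list.map kern_chain.simps
      by (rule nn_integral_mono) (use B(2) in \<open>auto simp: sum_kernel_apply\<close>)
    also have "\<dots> \<le> ennreal (2 * B * sqrt n)" by (rule sum_inverse_sqrt_le[OF B(1)])
    finally show ?thesis .
  qed
  then show ?case using B(1) by (intro exI[of _ "2 * B"]) simp
qed

text \<open>An admissible block at the front improves the decay to \<open>1 / (m * sqrt m)\<close>,
  which is summable. It is here that a block other than \<open>[1]\<close> matters.\<close>

lemma free_sum_trace_finite:
  assumes "admissible_index ks" "\<And>ls. ls \<in> set kk \<Longrightarrow> admissible_index ls \<or> ls = [1]"
  shows "kern_trace (count_space {1..}) ((\<lambda>_. \<lambda>m. ennreal (1 / real m ^ hd ks))
    # map sum_kernel (map (Pair False) (tl ks) @ concat (map block_word kk))) < \<infinity>"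
proof -
  interpret N: sigma_finite_measure "count_space {1::nat..}" by (rule sigma_finite_count_nat)
  let ?cs = "map (Pair False) (tl ks) @ concat (map block_word kk)"
  obtain C where C: "C \<ge> 0" "\<And>n. n > 0 \<Longrightarrow> sum_chain (concat (map block_word kk)) n \<le> ennreal (C * sqrt n)"
    using sum_chain_bound[OF assms(2)] by blast
  obtain B where B: "B \<ge> 0"
    "\<And>n. n > 0 \<Longrightarrow> ennreal (1 / real n ^ hd ks) * sum_chain ?cs n \<le> ennreal (B / (n * sqrt n))"
    using admissible_head_bound[OF assms(1) C] by blast
  have "kern_trace (count_space {1..}) ((\<lambda>_. \<lambda>m. ennreal (1 / real m ^ hd ks)) # map sum_kernel ?cs)
      = (\<integral>\<^sup>+m. ennreal (1 / real m ^ hd ks) * sum_chain ?cs m \<partial>count_space {1..})"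
    by (rule N.kern_trace_free) (simp add: kernel_on_count_space)
  also have "\<dots> \<le> (\<integral>\<^sup>+m. ennreal (B / (m * sqrt m)) \<partial>count_space {1::nat..})"
    by (rule nn_integral_mono) (use B(2) in auto)
  also have "\<dots> < \<infinity>" by (rule sum_inverse_sqrt_finite[OF B(1)])
  finally show ?thesis .
qed

section \<open>Comparison of the two traces\<close>

abbreviation int_trace :: "(bool \<times> nat) list \<Rightarrow> ennreal" where
  "int_trace cs \<equiv> kern_trace lborel (concat (map int_kernels cs))"

abbreviation sum_trace :: "(bool \<times> nat) list \<Rightarrow> ennreal" where
  "sum_trace cs \<equiv> kern_trace (count_space {1..}) (map sum_kernel cs)"

lemma int_trace_append_commute: "int_trace (cs @ ds) = int_trace (ds @ cs)"
  unfolding map_append concat_append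
  by (rule lborel.kern_trace_append_commute) (auto simp: kernel_on_int_kernels)

lemma sum_trace_append_commute: "sum_trace (cs @ ds) = sum_trace (ds @ cs)"
  unfolding map_append
  by (rule sigma_finite_measure.kern_trace_append_commute[OF sigma_finite_count_nat])
    (simp add: kernel_on_count_space)

lemma int_trace_strict_zero:
  assumes "\<And>c. c \<in> set cs \<Longrightarrow> \<not> fst c"
  shows "int_trace cs = 0"
proof (rule kern_trace_strict_zero)
  fix k :: "real \<Rightarrow> real \<Rightarrow> ennreal" and x y :: real
  assume "k \<in> set (concat (map int_kernels cs))" and xy: "\<not> x < y"
  then obtain c where "c \<in> set cs" and k: "k \<in> set (int_kernels c)" by auto
  then have "\<not> fst c" using assms by simp
  then have "k = rel_kernel {0<..<1} (<) (\<lambda>t. 1 / (1 - t)) \<or> k = up_kernel"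
    using k by (auto simp: int_kernels_def)
  then show "k x y = 0" using xy by (auto simp: rel_kernel_def up_kernel_def)
qed

lemma sum_trace_strict_zero:
  assumes "\<And>c. c \<in> set cs \<Longrightarrow> \<not> fst c"
  shows "sum_trace cs = 0"
  by (rule kern_trace_strict_zero) (use assms in \<open>auto simp: sum_kernel_def rel_kernel_def\<close>)

text \<open>The conditions \<open>m \<le> n\<close> and \<open>n < m\<close> are complementary, so
  adding both closing kernels removes the closing condition.\<close>

lemma sum_trace_split:
  "sum_trace ((True, k) # cs) + sum_trace ((False, k) # cs)
    = kern_trace (count_space {1..}) ((\<lambda>_. \<lambda>m. ennreal (1 / real m ^ k)) # map sum_kernel cs)"
proof -
  interpret N: sigma_finite_measure "count_space {1::nat..}" by (rule sigma_finite_count_nat)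
  have "kern_trace (count_space {1..}) ((\<lambda>_. \<lambda>m. ennreal (1 / real m ^ k)) # map sum_kernel cs)
    = kern_trace (count_space {1..}) ((\<lambda>x y. sum_kernel (True, k) x y + sum_kernel (False, k) x y) # map sum_kernel cs)"
    unfolding kern_trace.simps
  proof (rule nn_integral_cong)
    fix m :: nat assume "m \<in> space (count_space {1..})"
    then have "ennreal (1 / real m ^ k) = sum_kernel (True, k) n m + sum_kernel (False, k) n m" for n
      by (auto simp: sum_kernel_apply)
    then show "kern_chain (count_space {1..}) (\<lambda>y. ennreal (1 / real m ^ k)) (map sum_kernel cs) m
      = kern_chain (count_space {1..}) (\<lambda>y. sum_kernel (True, k) y m + sum_kernel (False, k) y m) (map sum_kernel cs) m"
      by simp
  qed
  also have "\<dots> = sum_trace ((True, k) # cs) + sum_trace ((False, k) # cs)"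
    by (subst N.kern_trace_head_add) (simp_all add: kernel_on_count_space)
  finally show ?thesis by simp
qed

text \<open>
  With \<open>k = 1\<close> and \<open>cs = []\<close> the only variable would be compared with itself, so both traces on the
  left would vanish while the right-hand side is infinite.
\<close>

lemma int_trace_split:
  assumes "2 \<le> k \<or> cs \<noteq> []"
  shows "int_trace ((True, k) # cs) + int_trace ((False, k) # cs)
    = kern_trace lborel ((\<lambda>_. \<lambda>u. ennreal (1 / (1 - u)) * indicator {0<..<1} u)
        # replicate (k - 1) up_kernel @ concat (map int_kernels cs))"
proof -
  let ?vs = "replicate (k - 1) up_kernel @ concat (map int_kernels cs)"
  let ?K = "\<lambda>d. rel_kernel {0<..<1} (if d then (>) else (<)) (\<lambda>t::real. 1 / (1 - t))"
  have vs: "\<And>k. k \<in> set ?vs \<Longrightarrow> kernel_on lborel k"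
    by (auto simp: kernel_on_up_kernel kernel_on_int_kernels)
  have ne: "?vs \<noteq> []" using assms by (cases cs) (auto simp: int_kernels_def)
  have "kern_trace lborel ((\<lambda>_. \<lambda>u. ennreal (1 / (1 - u)) * indicator {0<..<1} u) # ?vs)
    = kern_trace lborel ((\<lambda>x y. ?K True x y + ?K False x y) # ?vs)"
    unfolding kern_trace.simps
  proof (rule nn_integral_cong)
    fix u :: real
    \<comment> \<open>The two strict orders miss only the diagonal \<open>y = u\<close>, a null set
      in the variable \<open>y\<close>.\<close>
    have "AE y in lborel. ennreal (1 / (1 - u)) * indicator {0<..<1} u = ?K True y u + ?K False y u"
      using AE_lborel_singleton[of u] by eventually_elim (auto simp: rel_kernel_def)
    from kern_chain_AE_cong[OF this ne]
    show "kern_chain lborel (\<lambda>y. ennreal (1 / (1 - u)) * indicator {0<..<1} u) ?vs u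
      = kern_chain lborel (\<lambda>y. ?K True y u + ?K False y u) ?vs u" .
  qed
  also have "\<dots> = kern_trace lborel (?K True # ?vs) + kern_trace lborel (?K False # ?vs)"
    by (rule lborel.kern_trace_head_add) (use vs kernel_on_int_head in blast)+
  finally show ?thesis by (simp add: int_kernels_def)
qed

text \<open>Merging two blocks changes the descent between them into an ascent, which is exactly the
  other term of the splitting.\<close>

lemma block_word_append: "ls \<noteq> [] \<Longrightarrow> block_word (ls @ ks) = block_word ls @ map (Pair False) ks"
  by (simp add: block_word_def)

lemma snd_block_word_pos:
  assumes "admissible_index ks \<or> ks = [1]" "c \<in> set (block_word ks)"
  shows "snd c > 0"
proof -
  have "ks \<noteq> []" "\<forall>k\<in>set ks. 1 \<le> k" using assms(1) by (auto simp: admissible_index_def)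
  then show ?thesis using assms(2) by (cases ks) (auto simp: block_word_def Suc_le_eq)
qed

text \<open>Finiteness comes from the open trace of the sum, which dominates both closed ones, and
  it permits cancelling the merged term in \<open>ennreal\<close>.\<close>

lemma int_trace_eq_sum_trace:
  assumes "admissible_cyclic_index kk"
  shows "int_trace (concat (map block_word kk)) = sum_trace (concat (map block_word kk)) \<and>
    sum_trace (concat (map block_word kk)) < \<infinity>"
  using assms
proof (induction "length kk" arbitrary: kk rule: less_induct)
  case less
  have good: "\<And>ks. ks \<in> set kk \<Longrightarrow> admissible_index ks \<or> ks = [1]"
    using less.prems by (auto simp: admissible_cyclic_index_def)
  obtain ks where ks: "ks \<in> set kk" "admissible_index ks"
    using less.prems by (auto simp: admissible_cyclic_index_def)
  obtain xs ys where kk: "kk = xs @ ks # ys" using split_list[OF ks(1)] by blast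
  \<comment> \<open>The blocks that follow \<open>ks\<close> in cyclic order, so that the cycle can
    be read from \<open>ks\<close> on.\<close>
  define zs where "zs = ys @ xs"
  have gz: "\<And>ls. ls \<in> set zs \<Longrightarrow> admissible_index ls \<or> ls = [1]"
    using good by (auto simp: zs_def kk)
  let ?W = "\<lambda>kk. concat (map block_word kk)"
  have rot: "int_trace (?W kk) = int_trace (?W (ks # zs))" "sum_trace (?W kk) = sum_trace (?W (ks # zs))"
    using int_trace_append_commute[of "?W xs" "?W (ks # ys)"] sum_trace_append_commute[of "?W xs" "?W (ks # ys)"]
    by (simp_all add: kk zs_def)
  define k where "k = hd ks"
  define cs where "cs = map (Pair False) (tl ks) @ ?W zs"
  have W: "?W (ks # zs) = (True, k) # cs" by (simp add: block_word_def k_def cs_def)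
  have ksne: "ks \<noteq> []" using ks(2) by (simp add: admissible_index_def)
  have k: "k > 0" using snd_block_word_pos[of ks "(True, k)"] ks(2) by (simp add: block_word_def k_def)
  have pos: "\<And>c. c \<in> set cs \<Longrightarrow> snd c > 0"
  proof -
    fix c assume "c \<in> set cs"
    then have "c \<in> set (?W (ks # zs))" unfolding W by simp
    then obtain ls where "ls \<in> set (ks # zs)" "c \<in> set (block_word ls)" by auto
    then show "snd c > 0" using snd_block_word_pos[of ls c] gz[of ls] ks(2) by auto
  qed
  \<comment> \<open>If \<open>cs\<close> is empty then \<open>ks\<close> is \<open>[k]\<close>, and
    admissibility gives \<open>2 \<le> k\<close>. This rules out a cycle with a single integration
    variable.\<close>
  have k2: "2 \<le> k \<or> cs \<noteq> []"
    using ks(2) ksne by (cases ks) (auto simp: admissible_index_def k_def cs_def split: if_splits)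
  have sum: "int_trace ((True, k) # cs) + int_trace ((False, k) # cs)
      = sum_trace ((True, k) # cs) + sum_trace ((False, k) # cs)"
    using int_trace_split[OF k2] free_trace_eq[OF pos k] sum_trace_split[of k cs] by simp
  have "sum_trace ((True, k) # cs) + sum_trace ((False, k) # cs) < \<infinity>"
    unfolding sum_trace_split k_def cs_def by (rule free_sum_trace_finite[OF ks(2) gz])
  then have fin: "sum_trace ((True, k) # cs) < \<infinity>" "sum_trace ((False, k) # cs) < \<infinity>"
    by (auto simp: less_top)
  \<comment> \<open>Entering \<open>ks\<close> by an ascent joins it to the last of the other
    blocks; if there is none, the cycle is strictly increasing and both traces vanish.\<close>
  have "int_trace ((False, k) # cs) = sum_trace ((False, k) # cs)"
  proof (cases zs rule: rev_cases)
    case Nil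
    then show ?thesis
      by (subst int_trace_strict_zero; (subst sum_trace_strict_zero)?) (auto simp: cs_def)
  next
    case (snoc ws ls)
    have ls: "admissible_index ls \<or> ls = [1]" using gz snoc by simp
    then have lsne: "ls \<noteq> []" by (auto simp: admissible_index_def)
    \<comment> \<open>The last entry of the merged block is that of \<open>ks\<close>, so it is
      admissible even when \<open>ls\<close> is \<open>[1]\<close>.\<close>
    have adm: "admissible_index (ls @ ks)" using ls ks(2) by (auto simp: admissible_index_def)
    have "length ((ls @ ks) # ws) < length kk"
      using arg_cong[OF snoc, of length] by (simp add: kk zs_def)
    moreover have "admissible_cyclic_index ((ls @ ks) # ws)"
      using adm gz snoc by (auto simp: admissible_cyclic_index_def admissible_index_def)
    ultimately have IH: "int_trace (?W ((ls @ ks) # ws)) = sum_trace (?W ((ls @ ks) # ws))"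
      using less.hyps by blast
    \<comment> \<open>The two words agree up to a rotation that brings \<open>ls\<close> to the
      front.\<close>
    have "(False, k) # cs = (map (Pair False) ks @ ?W ws) @ block_word ls"
      using ksne by (cases ks) (simp_all add: cs_def k_def snoc)
    moreover have "?W ((ls @ ks) # ws) = block_word ls @ map (Pair False) ks @ ?W ws"
      using lsne by (simp add: block_word_append)
    ultimately show ?thesis using IH int_trace_append_commute sum_trace_append_commute by metis
  qed
  with sum fin have "int_trace ((True, k) # cs) = sum_trace ((True, k) # cs)"
    by (metis ennreal_add_left_cancel add.commute less_irrefl infinity_ennreal_def)
  then show ?case unfolding rot W using fin(1) by blast
qed

section \<open>Identification with the sum and the integral of the theorem\<close>

text \<open>The partial sums are exactly the indices where a new letter begins, so each letter gives
  one form \<open>dt / (1 - t)\<close> followed by forms \<open>dt / t\<close>. The flag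
  \<open>d\<close> is general because the induction continues with the rest of a block, which is
  entered by an ascent.\<close>

lemma int_kernels_block:
  assumes "\<forall>k\<in>set ks. 1 \<le> k"
  shows "map (\<lambda>j. rel_kernel {0<..<1} (if j = 0 \<and> d then (>) else (<))
      (\<lambda>x. if j \<in> {sum_list (take m ks) |m. m < length ks} then 1 / (1 - x) else 1 / x)) [0..<sum_list ks]
    = concat (map int_kernels (case ks of [] \<Rightarrow> [] | k # ks' \<Rightarrow> (d, k) # map (Pair False) ks'))"
  using assms
proof (induction ks arbitrary: d)
  case Nil
  then show ?case by simp
next
  case (Cons k ks)
  let ?S = "\<lambda>ks. {sum_list (take m ks) |m. m < length ks}"
  let ?K = "\<lambda>d ks j. rel_kernel {0<..<1} (if j = 0 \<and> d then (>) else (<))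
      (\<lambda>x::real. if j \<in> ?S ks then 1 / (1 - x) else 1 / x)"
  have k: "k \<ge> 1" using Cons.prems by simp
  \<comment> \<open>Prepending \<open>k\<close> shifts the old partial sums by \<open>k\<close> and
    adds 0. As the shifted ones are at least \<open>k\<close>, the indices strictly between 0 and
    \<open>k\<close> carry \<open>1 / x\<close>.\<close>
  have S: "?S (k # ks) = insert 0 ((+) k ` ?S ks)"
  proof (intro set_eqI iffI)
    fix j assume "j \<in> ?S (k # ks)"
    then obtain m where m: "j = sum_list (take m (k # ks))" "m < Suc (length ks)" by auto
    then show "j \<in> insert 0 ((+) k ` ?S ks)" by (cases m) auto
  next
    fix j assume "j \<in> insert 0 ((+) k ` ?S ks)"
    then consider "j = 0" | m where "j = k + sum_list (take m ks)" "m < length ks" by auto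
    then show "j \<in> ?S (k # ks)"
    proof cases
      case 1
      then show ?thesis by (auto intro!: exI[of _ 0])
    next
      case 2
      then show ?thesis by (auto intro!: exI[of _ "Suc m"])
    qed
  qed
  have "[0..<k + sum_list ks] = 0 # [1..<k] @ map (\<lambda>j. j + k) [0..<sum_list ks]"
    using k upt_add_eq_append[of 0 k "sum_list ks"] upt_conv_Cons[of 0 k] map_add_upt[of k "sum_list ks"]
    by (simp add: add.commute)
  then have "map (?K d (k # ks)) [0..<sum_list (k # ks)]
      = ?K d (k # ks) 0 # map (?K d (k # ks)) [1..<k] @ map (\<lambda>j. ?K d (k # ks) (j + k)) [0..<sum_list ks]"
    by (simp add: comp_def)
  also have "?K d (k # ks) 0 = rel_kernel {0<..<1} (if d then (>) else (<)) (\<lambda>t. 1 / (1 - t))"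
    unfolding S by simp
  also have "map (?K d (k # ks)) [1..<k] = replicate (k - 1) up_kernel"
  proof (rule nth_equalityI)
    fix i assume "i < length (map (?K d (k # ks)) [1..<k])"
    then have "i < k - 1" by simp
    moreover from this have "Suc i \<notin> insert 0 ((+) k ` ?S ks)" by auto
    ultimately show "map (?K d (k # ks)) [1..<k] ! i = replicate (k - 1) up_kernel ! i"
      unfolding S by (simp add: up_kernel_def)
  qed simp
  also have "map (\<lambda>j. ?K d (k # ks) (j + k)) [0..<sum_list ks] = map (?K False ks) [0..<sum_list ks]"
  proof (rule map_cong[OF refl])
    fix j
    have "j + k \<in> insert 0 ((+) k ` ?S ks) \<longleftrightarrow> j \<in> ?S ks" using k by (auto simp: add.commute)
    then show "?K d (k # ks) (j + k) = ?K False ks j" unfolding S using k by simp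
  qed
  also have "\<dots> = concat (map int_kernels (case ks of [] \<Rightarrow> [] | k # ks' \<Rightarrow> (False, k) # map (Pair False) ks'))"
    by (rule Cons.IH) (use Cons.prems in simp)
  also have "(case ks of [] \<Rightarrow> [] | k # ks' \<Rightarrow> (False, k) # map (Pair False) ks') = map (Pair False) ks"
    by (cases ks) auto
  finally show ?case by (simp add: int_kernels_def)
qed

lemma map_pos_list:
  "map L (pos_list (length kk) l) = concat (map (\<lambda>i. map (\<lambda>j. L (i, j)) [0..<l i]) [0..<length kk])"
  by (simp add: pos_list_def map_concat comp_def)

lemma concat_map_upt_nth:
  "concat (map (\<lambda>i. f (kk ! i)) [0..<length kk]) = concat (map f kk)"
  by (rule arg_cong[of _ _ concat], rule nth_equalityI) simp_all

lemma concat_map_concat_map: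
  "concat (map f (concat (map g xs))) = concat (map (\<lambda>x. concat (map f (g x))) xs)"
  by (induction xs) simp_all

text \<open>Summability and integrability belong to the conclusion because \<open>infsum\<close> and
  the integral would otherwise take the default value 0, and the equation could hold for that reason
  alone.\<close>

theorem theorem1p1:
  fixes kk :: "nat list list"
  assumes "admissible_cyclic_index kk"
  shows "cyc_summand kk summable_on cyc_summation_set kk \<and>
         set_integrable (cyc_measure kk) (cyc_domain kk) (cyc_integrand kk) \<and>
         zeta_cyc kk = (LINT t:cyc_domain kk|cyc_measure kk. cyc_integrand kk t)"
proof -
  interpret N: sigma_finite_measure "count_space {1::nat..}" by (rule sigma_finite_count_nat)
  let ?s = "length kk" and ?W = "concat (map block_word kk)"
  have s: "?s > 0" using assms by (auto simp: admissible_cyclic_index_def)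
  have ks: "kk ! i \<noteq> [] \<and> (\<forall>k\<in>set (kk ! i). 1 \<le> k)" if "i < ?s" for i
    using assms nth_mem[OF that] by (auto simp: admissible_cyclic_index_def admissible_index_def)
  have depth: "depth_of kk i > 0" if "i < ?s" for i using ks[OF that] by (simp add: depth_of_def)
  have weight: "weight_of kk i > 0" if "i < ?s" for i
    using ks[OF that] by (cases "kk ! i") (auto simp: weight_of_def)

  define fI where "fI = (\<lambda>p. cyc_form kk (fst p) (snd p))"
  \<comment> \<open>The integrand extended by zero outside the region, with values in
    \<open>ennreal\<close>, where the calculus of traces applies.\<close>
  define wI where "wI = (\<lambda>t. ennreal (\<Prod>i<?s. \<Prod>j<weight_of kk i. fI (i, j) (t (i, j)))
    * indicator (zigzag ?s (weight_of kk) {0<..<1::real} (<) (>)) t)"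
  have dom: "cyc_domain kk = zigzag ?s (weight_of kk) {0<..<1} (<) (>)"
    by (simp add: cyc_domain_def zigzag_def)
  have fI0: "0 \<le> fI p y" if "y \<in> {0<..<1}" for p y using that by (simp add: fI_def cyc_form_def)
  have kerI: "kernel_on lborel (rel_kernel {0<..<1} (if snd p = 0 then (>) else (<)) (fI p))" for p
  proof -
    have "fI p \<in> borel_measurable borel" unfolding fI_def cyc_form_def by measurable
    then show ?thesis
      using kernel_on_lborel_rel_kernel[OF _ pred_less_lborel(1)] kernel_on_lborel_rel_kernel[OF _ pred_less_lborel(2)]
      by simp
  qed
  have mI: "wI \<in> borel_measurable (cyc_measure kk)"
    unfolding wI_def cyc_measure_def
    by (rule lborel.nn_integral_zigzag(1)[OF s weight]) (use fI0 kerI in auto)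
  have "(\<integral>\<^sup>+t. wI t \<partial>cyc_measure kk)
      = kern_trace lborel (map (\<lambda>p. rel_kernel {0<..<1} (if snd p = 0 then (>) else (<)) (fI p)) (pos_list ?s (weight_of kk)))"
    unfolding wI_def cyc_measure_def
    by (rule lborel.nn_integral_zigzag(2)[OF s weight]) (use fI0 kerI in auto)
  also have "map (\<lambda>p. rel_kernel {0<..<1} (if snd p = 0 then (>) else (<)) (fI p)) (pos_list ?s (weight_of kk))
      = concat (map (\<lambda>i. concat (map int_kernels (block_word (kk ! i)))) [0..<?s])"
  proof -
    have "map (\<lambda>j. rel_kernel {0<..<1} (if snd (i, j) = 0 then (>) else (<)) (fI (i, j))) [0..<weight_of kk i]
        = concat (map int_kernels (block_word (kk ! i)))" if i: "i < ?s" for i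
    proof -
      have "(case kk ! i of [] \<Rightarrow> [] | k # ks' \<Rightarrow> (True, k) # map (Pair False) ks') = block_word (kk ! i)"
        using ks[OF i] by (cases "kk ! i") (auto simp: block_word_def)
      then show ?thesis
        using int_kernels_block[of "kk ! i" True] ks[OF i]
        by (simp add: fI_def cyc_form_def[abs_def] weight_of_def depth_of_def)
    qed
    then show ?thesis unfolding map_pos_list by (intro arg_cong[of _ _ concat] map_cong) auto
  qed
  also have "\<dots> = concat (map int_kernels ?W)"
    using concat_map_upt_nth[of "\<lambda>ks. concat (map int_kernels (block_word ks))" kk]
      concat_map_concat_map[of int_kernels block_word kk] by simp
  finally have intI: "(\<integral>\<^sup>+t. wI t \<partial>cyc_measure kk) = int_trace ?W" .

  define SB where "SB = block_positions ?s (depth_of kk)"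
  define fS where "fS = (\<lambda>p m. 1 / real m ^ (kk ! fst p ! snd p))"
  define wS where "wS = (\<lambda>n. ennreal (\<Prod>i<?s. \<Prod>j<depth_of kk i. fS (i, j) (n (i, j)))
    * indicator (zigzag ?s (depth_of kk) {1::nat..} (<) (\<ge>)) n)"
  have sset: "cyc_summation_set kk = zigzag ?s (depth_of kk) {1..} (<) (\<ge>)"
    by (simp add: cyc_summation_set_def zigzag_def)
  have "(\<integral>\<^sup>+n. wS n \<partial>Pi\<^sub>M SB (\<lambda>_. count_space {1..}))
      = kern_trace (count_space {1..}) (map (\<lambda>p. rel_kernel {1..} (if snd p = 0 then (\<ge>) else (<)) (fS p)) (pos_list ?s (depth_of kk)))"
    unfolding wS_def SB_def
    by (rule N.nn_integral_zigzag(2)[OF s depth]) (auto simp: fS_def kernel_on_count_space)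
  also have "map (\<lambda>p. rel_kernel {1..} (if snd p = 0 then (\<ge>) else (<)) (fS p)) (pos_list ?s (depth_of kk))
      = concat (map (\<lambda>i. map sum_kernel (block_word (kk ! i))) [0..<?s])"
  proof -
    have "map (\<lambda>j. rel_kernel {1..} (if snd (i, j) = 0 then (\<ge>) else (<)) (fS (i, j))) [0..<depth_of kk i]
        = map sum_kernel (block_word (kk ! i))" if i: "i < ?s" for i
      using ks[OF i]
      by (intro nth_equalityI)
        (auto simp: depth_of_def block_word_def sum_kernel_def fS_def nth_Cons nth_tl hd_conv_nth split: nat.split)
    then show ?thesis unfolding map_pos_list by (intro arg_cong[of _ _ concat] map_cong) auto
  qed
  also have "\<dots> = map sum_kernel ?W"
    using concat_map_upt_nth[of "\<lambda>ks. map sum_kernel (block_word ks)" kk]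
    by (simp add: map_concat comp_def)
  \<comment> \<open>A finite product of counting measures on a countable set is the counting measure
    on the extensional functions, so the integral is a sum.\<close>
  also have "Pi\<^sub>M SB (\<lambda>_. count_space {1..}) = count_space (SB \<rightarrow>\<^sub>E {1::nat..})"
    by (rule count_space_PiM_finite) (auto simp: SB_def block_positions_def)
  finally have intS: "(\<integral>\<^sup>+n. wS n \<partial>count_space (SB \<rightarrow>\<^sub>E {1..})) = sum_trace ?W" .

  have eq: "int_trace ?W = sum_trace ?W" and fin: "sum_trace ?W < \<infinity>"
    using int_trace_eq_sum_trace[OF assms] by auto

  have sub: "cyc_summation_set kk \<subseteq> SB \<rightarrow>\<^sub>E {1..}" by (auto simp: SB_def sset zigzag_def)
  have summand0: "0 \<le> cyc_summand kk n" for n by (auto simp: cyc_summand_def intro!: prod_nonneg)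
  have "(\<integral>\<^sup>+n. ennreal (cyc_summand kk n) \<partial>count_space (cyc_summation_set kk))
      = (\<integral>\<^sup>+n. ennreal (cyc_summand kk n) * indicator (cyc_summation_set kk) n \<partial>count_space UNIV)"
    by (simp add: nn_integral_count_space_indicator)
  also have "\<dots> = (\<integral>\<^sup>+n. wS n * indicator (SB \<rightarrow>\<^sub>E {1..}) n \<partial>count_space UNIV)"
    by (rule nn_integral_cong)
      (use sub in \<open>auto simp: wS_def cyc_summand_def fS_def sset indicator_def\<close>)
  also have "\<dots> = sum_trace ?W"
    unfolding intS[symmetric] by (simp add: nn_integral_count_space_indicator)
  finally have nnS: "(\<integral>\<^sup>+n. ennreal (cyc_summand kk n) \<partial>count_space (cyc_summation_set kk)) = sum_trace ?W" .
  \<comment> \<open>For nonnegative terms a finite integral over counting measure is absolute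
    summability, from which \<open>summable_on\<close> follows.\<close>
  have abs: "Infinite_Set_Sum.abs_summable_on (cyc_summand kk) (cyc_summation_set kk)"
    unfolding Infinite_Set_Sum.abs_summable_on_def
    by (rule integrableI_nonneg) (use nnS fin summand0 in auto)
  have summable: "cyc_summand kk summable_on cyc_summation_set kk"
    using abs by (simp add: abs_summable_equivalent[symmetric] abs_summable_summable)
  have zeta: "zeta_cyc kk = enn2real (sum_trace ?W)"
  proof -
    have "zeta_cyc kk = infsetsum (cyc_summand kk) (cyc_summation_set kk)"
      unfolding zeta_cyc_def by (rule infsetsum_infsum[OF abs, symmetric])
    also have "\<dots> = enn2real (sum_trace ?W)"
      unfolding infsetsum_def nnS[symmetric] by (rule integral_eq_nn_integral) (use summand0 in auto)
    finally show ?thesis .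
  qed

  let ?g = "\<lambda>t. indicator (cyc_domain kk) t *\<^sub>R cyc_integrand kk t"
  have g0: "0 \<le> ?g t" for t
  proof (cases "t \<in> cyc_domain kk")
    case True
    have "0 \<le> cyc_form kk i j (t (i, j))" if "i < ?s" "j < weight_of kk i" for i j
    proof -
      have "t (i, j) \<in> {0<..<1}"
        using True that by (auto simp: cyc_domain_def block_positions_def PiE_def Pi_def)
      then show ?thesis by (simp add: cyc_form_def)
    qed
    then have "0 \<le> cyc_integrand kk t" unfolding cyc_integrand_def by (intro prod_nonneg) auto
    then show ?thesis by simp
  qed simp
  have wIg: "wI t = ennreal (?g t)" for t
    by (auto simp: wI_def dom fI_def cyc_integrand_def indicator_def)
  \<comment> \<open>Measurability of the integrand cut off to the region is inherited from
    \<open>wI\<close>, where it came from the product of kernels.\<close>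
  then have "?g = (\<lambda>t. enn2real (wI t))" using g0 by simp
  then have gm: "?g \<in> borel_measurable (cyc_measure kk)" using mI by simp
  have nnI: "(\<integral>\<^sup>+t. ennreal (?g t) \<partial>cyc_measure kk) = int_trace ?W"
    using intI wIg by simp
  have "set_integrable (cyc_measure kk) (cyc_domain kk) (cyc_integrand kk)"
    unfolding set_integrable_def
    by (rule integrableI_nonneg[OF gm]) (use g0 nnI eq fin in auto)
  moreover have "(LINT t:cyc_domain kk|cyc_measure kk. cyc_integrand kk t) = enn2real (int_trace ?W)"
    unfolding set_lebesgue_integral_def nnI[symmetric]
    by (rule integral_eq_nn_integral[OF gm]) (use g0 in auto)
  ultimately show ?thesis using summable zeta eq by simp
qed

end
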